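(* Let $g,\mathsf{h},\mathsf{c}$ be integers with $\mathsf{h}\geq 0$, $g=2\mathsf{h}+\mathsf{c}>0$ and $\mathsf{c}>0$. Let $\mathsf{h}_0=\lceil\frac{\mathsf{c}}{2}\rceil-1$ and $\mathsf{c}_0=\mathsf{c}-2\mathsf{h}_0$. Then, for every integer $k>0$, the following hold: - every mixed surface grid of order $162^{2g}k$ with $\mathsf{h}$ handles and $\mathsf{c}$ crosscaps contains $\mathscr{D}^{(\mathsf{h}+\mathsf{h}_0,\mathsf{c}_0)}_k$ as a minor, and - $\mathscr{D}^{(\mathsf{h}+\mathsf{h}_0,\mathsf{c}_0)}_{162^{2g}k}$ contains every mixed surface grid of order $k$ with $\mathsf{h}$ handles and $\mathsf{c}$ crosscaps as a minor.
   Context: The $(m,n)$-cylindrical grid consists of $m$ disjoint cycles $C_1,\dots,C_m$, with $C_i$ having vertices $v^i_1,\dots,v^i_n$ in cyclic order, together with the edges $v^i_jv^{i+1}_j$ for $i\in[m-1]$, $j\in[n]$. In the $(m,n\cdot 4m)$-cylindrical grid, adding a handle at position $i\in[n]$ means adding the edges $\{v^1_{4m(i-1)+j}v^1_{4m(i-1)+3m-j+1}\mid j\in[m]\}\cup\{v^1_{4m(i-1)+m+j}v^1_{4m(i-1)+4m-j+1}\mid j\in[m]\}$, and adding a crosscap at position $i$ means adding the edges $\{v^1_{4m(i-1)+j}v^1_{4m(i-1)+2m+j}\mid j\in[2m]\}$. A mixed surface grid of order $k$ with $\mathsf{h}$ handles and $\mathsf{c}$ crosscaps is any graph obtained as follows: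 take a partition of $\{2,\dots,\mathsf{h}+\mathsf{c}+1\}$ into sets $I_{\text{hndl}},I_{\text{crscp}}$ with $|I_{\text{hndl}}|=\mathsf{h}$ and $|I_{\text{crscp}}|=\mathsf{c}$, and, starting from the $(k,4(\mathsf{h}+\mathsf{c}+1)k)$-cylindrical grid, add a handle at every position $i\in I_{\text{hndl}}$ and a crosscap at every position $i\in I_{\text{crscp}}$. The Dyck-grid $\mathscr{D}^{(\mathsf{h},\mathsf{c})}_k$ is the mixed surface grid of order $k$ with $I_{\text{hndl}}=\{2,\dots,\mathsf{h}+1\}$ and $I_{\text{crscp}}=\{\mathsf{h}+2,\dots,\mathsf{h}+\mathsf{c}+1\}$. *)

theory Defs
  imports Complex_Main "Graph_Theory.Graph_Theory"
begin

text \<open>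
  Undirected graphs are symmetric pair digraphs: an edge between \<open>u\<close> and \<open>v\<close> is the pair of arcs
  \<open>(u, v)\<close>, \<open>(v, u)\<close>. Edge sets are written with one orientation per edge and closed under \<^const>\<open>symcl\<close>.
  The vertex \<open>v\<^sup>i\<^sub>j\<close> is \<open>(i, j)\<close>; all indices start at 1.
\<close>

definition cylindrical_grid :: "nat \<Rightarrow> nat \<Rightarrow> (nat \<times> nat) pair_pre_digraph" where
  "cylindrical_grid m n =
     \<lparr> pverts = {1..m} \<times> {1..n},
       parcs = symcl ({((i, j), (i, j mod n + 1)) | i j. i \<in> {1..m} \<and> j \<in> {1..n}} \<union>
                      {((i, j), (i + 1, j)) | i j. i \<in> {1..<m} \<and> j \<in> {1..n}}) \<rparr>"

definition handle_edges :: "nat \<Rightarrow> nat \<Rightarrow> (nat \<times> nat) rel" where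
  "handle_edges m i =
     {((1, 4*m*(i-1) + j), (1, 4*m*(i-1) + 3*m - j + 1)) | j. j \<in> {1..m}} \<union>
     {((1, 4*m*(i-1) + m + j), (1, 4*m*(i-1) + 4*m - j + 1)) | j. j \<in> {1..m}}"

definition crosscap_edges :: "nat \<Rightarrow> nat \<Rightarrow> (nat \<times> nat) rel" where
  "crosscap_edges m i = {((1, 4*m*(i-1) + j), (1, 4*m*(i-1) + 2*m + j)) | j. j \<in> {1..2*m}}"

text \<open>
  The \<open>(m, n \<cdot> 4m)\<close>-cylindrical grid with handles added at the positions in \<open>Ih\<close> and crosscaps
  added at the positions in \<open>Ic\<close>.
\<close>

definition surface_grid ::
    "nat \<Rightarrow> nat \<Rightarrow> nat set \<Rightarrow> nat set \<Rightarrow> (nat \<times> nat) pair_pre_digraph" where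
  "surface_grid m n Ih Ic =
     \<lparr> pverts = pverts (cylindrical_grid m (n * (4*m))),
       parcs = parcs (cylindrical_grid m (n * (4*m))) \<union>
               symcl ((\<Union>i\<in>Ih. handle_edges m i) \<union> (\<Union>i\<in>Ic. crosscap_edges m i)) \<rparr>"

text \<open>In this partition, either of the two parts may be empty.\<close>

definition mixed_surface_grid :: "nat \<Rightarrow> nat \<Rightarrow> nat \<Rightarrow> (nat \<times> nat) pair_pre_digraph \<Rightarrow> bool" where
  "mixed_surface_grid k h c G \<longleftrightarrow>
     (\<exists>Ih Ic. Ih \<union> Ic = {2..h+c+1} \<and> Ih \<inter> Ic = {} \<and> card Ih = h \<and> card Ic = c \<and>
              G = surface_grid k (h+c+1) Ih Ic)"

definition dyck_grid :: "nat \<Rightarrow> nat \<Rightarrow> nat \<Rightarrow> (nat \<times> nat) pair_pre_digraph" where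
  "dyck_grid h c k = surface_grid k (h+c+1) {2..h+1} {h+2..h+c+1}"

text \<open>
  \<open>H\<close> is a minor of \<open>G\<close>, up to isomorphism: contracting the pairwise disjoint connected branch sets
  \<open>\<mu> x\<close> in a subgraph of \<open>G\<close> yields \<open>H\<close>. Branch sets are nonempty because
  \<^const>\<open>connected\<close> excludes the empty graph.
\<close>

definition is_minor :: "'a pair_pre_digraph \<Rightarrow> 'b pair_pre_digraph \<Rightarrow> bool" where
  "is_minor H G \<longleftrightarrow>
     (\<exists>\<mu> :: 'a \<Rightarrow> 'b set.
        (\<forall>x\<in>pverts H. \<mu> x \<subseteq> pverts G \<and> connected (with_proj G \<restriction> \<mu> x)) \<and>
        (\<forall>x\<in>pverts H. \<forall>y\<in>pverts H. x \<noteq> y \<longrightarrow> \<mu> x \<inter> \<mu> y = {}) \<and>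
        (\<forall>(x, y)\<in>parcs H. \<exists>u\<in>\<mu> x. \<exists>v\<in>\<mu> y. (u, v) \<in> parcs G))"

lemma mixed_surface_grid_dyck_grid: "mixed_surface_grid k h c (dyck_grid h c k)"
  unfolding mixed_surface_grid_def dyck_grid_def
  by (rule exI[of _ "{2..h+1}"], rule exI[of _ "{h+2..h+c+1}"]) auto

end

theory Submission
  imports Defs "HOL-Library.Sublist"
begin

text \<open>
  The edges added to the innermost cycle form a word: every column carries a letter, and two columns are
  adjacent iff they carry the same letter. A handle contributes \<open>a b a\<^sup>- b\<^sup>-\<close> and a crosscap \<open>x x\<close>, where
  \<open>a\<close>, \<open>b\<close>, \<open>x\<close> are strips of parallel letters and \<open>a\<^sup>-\<close> is the reversal of \<open>a\<close>. Deleting letters yields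
  a minor. So does joining two neighbouring letters \<open>a b\<close> on the first cycle, which concatenates their
  edges and costs one cycle of depth. Iterated joins slide a block \<open>Y\<close> along a parallel part of a
  crosscap strip, exchanging \<open>x Y x\<close> with \<open>x x Y\<^sup>-\<close> and \<open>Y\<^sup>- x x\<close>. As in the classification of surfaces,
  such slides commute a crosscap with a handle and turn a handle next to a crosscap into three
  crosscaps, and back. Each exchange costs a constant factor of the order, so all mixed surface grids
  with \<open>c > 0\<close> and the same \<open>2 h + c\<close> are compared through the grid with \<open>2 h + c\<close> crosscaps.
\<close>

section \<open>Lists\<close>

lemma subseq_rev: "subseq xs ys \<Longrightarrow> subseq (rev xs) (rev ys)"
  by (induction rule: list_emb.induct) (auto intro: list_emb_append_mono subseq_rev_drop_many)

lemma subseq_set: "subseq xs ys \<Longrightarrow> set xs \<subseteq> set ys"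
  by (auto simp: subseq_conv_nths dest: in_set_nthsD)

lemma subseq_distinct: "subseq xs ys \<Longrightarrow> distinct ys \<Longrightarrow> distinct xs"
  by (auto simp: subseq_conv_nths intro: distinct_nthsI)

lemma subseq_concat_map:
  assumes "\<And>x. x \<in> set xs \<Longrightarrow> subseq (f x) (g x)"
  shows "subseq (concat (map f xs)) (concat (map g xs))"
  using assms by (induction xs) (auto intro: list_emb_append_mono)

lemma subseq_take: "subseq (take n xs) xs"
  by (intro prefix_imp_subseq take_is_prefix)

lemma subseq_take_take: "m \<le> n \<Longrightarrow> subseq (take m xs) (take n xs)"
  by (metis min.absorb1 subseq_take take_take)

lemma subseq_append_left: "subseq xs (xs @ ys)"
  by (simp add: subseq_rev_drop_many)

lemma split_length_le:
  assumes "m + n \<le> length xs"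
  shows "\<exists>ys zs rest. xs = ys @ zs @ rest \<and> length ys = m \<and> length zs = n"
  by (rule exI[of _ "take m xs"], rule exI[of _ "take n (drop m xs)"], rule exI[of _ "drop n (drop m xs)"])
    (use assms in \<open>simp only: append_take_drop_id length_take length_drop, simp\<close>)

lemma split_length_le3:
  assumes "l + m + n \<le> length xs"
  shows "\<exists>ws ys zs rest. xs = ws @ ys @ zs @ rest \<and> length ws = l \<and> length ys = m \<and> length zs = n"
proof -
  obtain us zs rest where "xs = us @ zs @ rest" "length us = l + m" "length zs = n"
    using assms split_length_le by blast
  moreover from this obtain ws ys rest' where "us = ws @ ys @ rest'" "length ws = l" "length ys = m"
    using split_length_le[of l m us] by auto
  ultimately show ?thesis
    by (intro exI[of _ ws] exI[of _ ys] exI[of _ zs] exI[of _ rest]) auto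
qed

lemma nth_concat_uniform:
  assumes "\<And>xs. xs \<in> set xss \<Longrightarrow> length xs = m" "i < length xss" "r < m"
  shows "concat xss ! (m * i + r) = xss ! i ! r"
  using assms
proof (induction xss arbitrary: i)
  case (Cons xs xss)
  then show ?case
    by (cases i) (auto simp: nth_append)
qed simp

lemma length_concat_uniform:
  assumes "\<And>xs. xs \<in> set xss \<Longrightarrow> length xs = m"
  shows "length (concat xss) = m * length xss"
  using assms by (induction xss) auto

lemma distinct_concat_nth_disjoint:
  assumes "distinct (concat xss)" "i < length xss" "j < length xss" "x \<in> set (xss ! i)" "x \<in> set (xss ! j)"
  shows "i = j"
  using assms
proof (induction xss arbitrary: i j)
  case (Cons xs xss)
  have "y \<notin> set xs" if "y \<in> set (xss ! l)" "l < length xss" for y l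
    using Cons.prems(1) that nth_mem[OF that(2)] by fastforce
  with Cons show ?case
    by (cases i; cases j) auto
qed simp

section \<open>Minors\<close>

abbreviation linked :: "'a pair_pre_digraph \<Rightarrow> 'a set \<Rightarrow> bool" where
  "linked G S \<equiv> connected (with_proj G \<restriction> S)"

text \<open>\<open>rtrancl_on S\<close> keeps every vertex of a walk inside \<open>S\<close>, so
  only arcs with both ends in \<open>S\<close> are ever used. Passing from all arcs of
  \<open>G\<close> to those of the induced subgraph therefore changes nothing.\<close>

lemma linked_iff:
  "linked G S \<longleftrightarrow> S \<noteq> {} \<and> (\<forall>u\<in>S. \<forall>v\<in>S. (u, v) \<in> rtrancl_on S (symcl (parcs G)))"
proof -
  have ends: "arcs_ends (with_proj G \<restriction> S) = parcs G \<inter> S \<times> S"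
    by (auto simp: arcs_ends_conv induce_subgraph_def with_proj_def)
  have "rtrancl_on S (symcl (parcs G \<inter> S \<times> S)) = rtrancl_on S (symcl (parcs G))"
  proof (intro equalityI subrelI)
    fix u v
    assume "(u, v) \<in> rtrancl_on S (symcl (parcs G \<inter> S \<times> S))"
    then show "(u, v) \<in> rtrancl_on S (symcl (parcs G))"
      by (rule rtrancl_on_mono[rotated 2]) (auto simp: symcl_def)
  next
    fix u v
    assume "(u, v) \<in> rtrancl_on S (symcl (parcs G))"
    then show "(u, v) \<in> rtrancl_on S (symcl (parcs G \<inter> S \<times> S))"
    proof (induction rule: rtrancl_on_induct)
      case base
      then show ?case by (rule rtrancl_on_refl)
    next
      case (step y z)
      then have "(y, z) \<in> symcl (parcs G \<inter> S \<times> S)"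
        by (auto simp: symcl_def)
      with step show ?case by (meson rtrancl_on_into_rtrancl_on)
    qed
  qed
  then show ?thesis by (simp only: connected_conv ends induce_subgraph_verts)
qed

lemma linked_singleton: "linked G {v}"
  by (simp add: linked_iff)

text \<open>Needed to compose minor models. A walk in \<open>S\<close> lifts step by step: each arc
  gives an arc between the branch sets of its ends, and connectedness inside a branch set leads on
  to the next arc.\<close>

lemma linked_Union:
  assumes S: "linked G S"
    and \<nu>: "\<And>x. x \<in> S \<Longrightarrow> linked F (\<nu> x)"
    and adj: "\<And>x y. x \<in> S \<Longrightarrow> y \<in> S \<Longrightarrow> (x, y) \<in> parcs G \<Longrightarrow> \<exists>u\<in>\<nu> x. \<exists>v\<in>\<nu> y. (u, v) \<in> parcs F"
  shows "linked F (\<Union>x\<in>S. \<nu> x)"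
proof -
  let ?R = "rtrancl_on (\<Union>x\<in>S. \<nu> x) (symcl (parcs F))"
  have inner: "(u, v) \<in> ?R" if "x \<in> S" "u \<in> \<nu> x" "v \<in> \<nu> x" for x u v
  proof -
    have "(u, v) \<in> rtrancl_on (\<nu> x) (symcl (parcs F))"
      using \<nu>[OF \<open>x \<in> S\<close>] that by (simp add: linked_iff)
    then show ?thesis
      by (rule rtrancl_on_mono[rotated 2]) (use that in auto)
  qed
  have "(u, v) \<in> ?R" if "(x, y) \<in> rtrancl_on S (symcl (parcs G))" "u \<in> \<nu> x" "v \<in> \<nu> y" for x y u v
    using that
  proof (induction arbitrary: v rule: rtrancl_on_induct)
    case base
    then show ?case using inner by blast
  next
    case (step y z)
    then have "(y, z) \<in> parcs G \<or> (z, y) \<in> parcs G"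
      by (auto simp: symcl_def)
    then obtain p q where pq: "p \<in> \<nu> y" "q \<in> \<nu> z" "(p, q) \<in> symcl (parcs F)"
      using adj[of y z] adj[of z y] step.hyps by (fastforce simp: symcl_def)
    have "(u, p) \<in> ?R"
      using step pq by blast
    then have "(u, q) \<in> ?R"
      using pq step.hyps by (blast intro: rtrancl_on_into_rtrancl_on)
    then show ?case
      using inner[of z q v] step pq by (blast intro: rtrancl_on_trans)
  qed
  moreover have "(\<Union>x\<in>S. \<nu> x) \<noteq> {}"
    using S \<nu> by (fastforce simp: linked_iff)
  ultimately show ?thesis
    using S unfolding linked_iff[of F] linked_iff[of G S] by blast
qed

lemma linked_insert:
  assumes S: "linked G S" and v: "v \<in> S" and uv: "(u, v) \<in> parcs G \<or> (v, u) \<in> parcs G"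
  shows "linked G (insert u S)"
proof -
  let ?R = "rtrancl_on (insert u S) (symcl (parcs G))"
  have old: "(x, y) \<in> ?R" if "x \<in> S" "y \<in> S" for x y
  proof -
    have "(x, y) \<in> rtrancl_on S (symcl (parcs G))"
      using S that by (simp add: linked_iff)
    then show ?thesis
      by (rule rtrancl_on_mono[rotated 2]) auto
  qed
  have e: "(u, v) \<in> symcl (parcs G)" "(v, u) \<in> symcl (parcs G)"
    using uv by (force simp: symcl_def)+
  have "(u, v) \<in> ?R" "(v, u) \<in> ?R"
    using e v by (meson insertI1 insertI2 rtrancl_on_into_rtrancl_on rtrancl_on_refl)+
  then have "(u, y) \<in> ?R" "(y, u) \<in> ?R" if "y \<in> S" for y
    using old[OF v that] old[OF that v] by (blast intro: rtrancl_on_trans)+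
  then show ?thesis
    using old unfolding linked_iff by (auto intro: rtrancl_on_refl)
qed

lemma is_minor_iff:
  "is_minor H G \<longleftrightarrow>
     (\<exists>\<mu>. (\<forall>x\<in>pverts H. \<mu> x \<subseteq> pverts G) \<and> (\<forall>x\<in>pverts H. linked G (\<mu> x)) \<and>
          (\<forall>x\<in>pverts H. \<forall>y\<in>pverts H. x \<noteq> y \<longrightarrow> \<mu> x \<inter> \<mu> y = {}) \<and>
          (\<forall>x y. (x, y) \<in> parcs H \<longrightarrow> (\<exists>u\<in>\<mu> x. \<exists>v\<in>\<mu> y. (u, v) \<in> parcs G)))"
  by (simp only: is_minor_def Ball_def split_paired_All prod.case conj_assoc all_conj_distrib imp_conjR)

lemma is_minorI:
  assumes "\<And>x. x \<in> pverts H \<Longrightarrow> \<mu> x \<subseteq> pverts G \<and> linked G (\<mu> x)"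
    and "\<And>x y. x \<in> pverts H \<Longrightarrow> y \<in> pverts H \<Longrightarrow> x \<noteq> y \<Longrightarrow> \<mu> x \<inter> \<mu> y = {}"
    and "\<And>x y. (x, y) \<in> parcs H \<Longrightarrow> \<exists>u\<in>\<mu> x. \<exists>v\<in>\<mu> y. (u, v) \<in> parcs G"
  shows "is_minor H G"
  unfolding is_minor_iff
  by (rule exI[of _ \<mu>], intro conjI ballI impI allI) (simp_all only: assms not_False_eq_True)

lemma is_minor_trans:
  assumes "is_minor H G" "is_minor G F"
  shows "is_minor H F"
proof -
  obtain \<mu> where
    \<mu>: "\<forall>x\<in>pverts H. \<mu> x \<subseteq> pverts G" "\<forall>x\<in>pverts H. linked G (\<mu> x)"
    and \<mu>_disj: "\<forall>x\<in>pverts H. \<forall>y\<in>pverts H. x \<noteq> y \<longrightarrow> \<mu> x \<inter> \<mu> y = {}"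
    and \<mu>_adj: "\<forall>x y. (x, y) \<in> parcs H \<longrightarrow> (\<exists>u\<in>\<mu> x. \<exists>v\<in>\<mu> y. (u, v) \<in> parcs G)"
    using assms(1) unfolding is_minor_iff by (elim exE conjE)
  obtain \<nu> where
    \<nu>: "\<forall>x\<in>pverts G. \<nu> x \<subseteq> pverts F" "\<forall>x\<in>pverts G. linked F (\<nu> x)"
    and \<nu>_disj: "\<forall>x\<in>pverts G. \<forall>y\<in>pverts G. x \<noteq> y \<longrightarrow> \<nu> x \<inter> \<nu> y = {}"
    and \<nu>_adj: "\<forall>x y. (x, y) \<in> parcs G \<longrightarrow> (\<exists>u\<in>\<nu> x. \<exists>v\<in>\<nu> y. (u, v) \<in> parcs F)"
    using assms(2) unfolding is_minor_iff by (elim exE conjE)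
  let ?\<rho> = "\<lambda>x. \<Union>y\<in>\<mu> x. \<nu> y"
  have "?\<rho> x \<subseteq> pverts F \<and> linked F (?\<rho> x)" if x: "x \<in> pverts H" for x
  proof
    have sub: "y \<in> pverts G" if "y \<in> \<mu> x" for y
      using \<mu>(1) x that by blast
    then show "?\<rho> x \<subseteq> pverts F"
      using \<nu>(1) by blast
    show "linked F (?\<rho> x)"
    proof (rule linked_Union)
      show "linked G (\<mu> x)" using \<mu>(2) x by (rule bspec)
      show "linked F (\<nu> y)" if "y \<in> \<mu> x" for y using \<nu>(2) sub[OF that] by (rule bspec)
    qed (use \<nu>_adj in blast)
  qed
  moreover have "?\<rho> x \<inter> ?\<rho> y = {}" if "x \<in> pverts H" "y \<in> pverts H" "x \<noteq> y" for x y
  proof -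
    have "u \<noteq> v \<and> u \<in> pverts G \<and> v \<in> pverts G" if "u \<in> \<mu> x" "v \<in> \<mu> y" for u v
      using that \<mu>(1) \<mu>_disj \<open>x \<in> pverts H\<close> \<open>y \<in> pverts H\<close> \<open>x \<noteq> y\<close> by blast
    then show ?thesis using \<nu>_disj by blast
  qed
  moreover have "\<exists>u\<in>?\<rho> x. \<exists>v\<in>?\<rho> y. (u, v) \<in> parcs F" if xy: "(x, y) \<in> parcs H" for x y
  proof -
    obtain u v where "u \<in> \<mu> x" "v \<in> \<mu> y" "(u, v) \<in> parcs G"
      using \<mu>_adj xy by blast
    moreover from this obtain p q where "p \<in> \<nu> u" "q \<in> \<nu> v" "(p, q) \<in> parcs F"
      using \<nu>_adj by blast
    ultimately show ?thesis by blast
  qed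
  ultimately show ?thesis
    by (rule is_minorI[of _ ?\<rho>])
qed

section \<open>Cylindrical grids whose chords are given by a word\<close>

text \<open>The letter 0 marks a column without chords.\<close>

definition word_grid :: "nat \<Rightarrow> nat list \<Rightarrow> (nat \<times> nat) pair_pre_digraph" where
  "word_grid d w =
     \<lparr> pverts = {1..d} \<times> {1..length w},
       parcs = parcs (cylindrical_grid d (length w)) \<union>
               {((1, p + 1), (1, q + 1)) | p q.
                  p < length w \<and> q < length w \<and> p \<noteq> q \<and> w ! p = w ! q \<and> w ! p \<noteq> 0} \<rparr>"

lemma pverts_word_grid [simp]: "pverts (word_grid d w) = {1..d} \<times> {1..length w}"
  by (simp add: word_grid_def)

lemma sym_symcl: "sym (symcl R)"
  by (force simp: symcl_def sym_def)

lemma sym_word_grid: "sym (parcs (word_grid d w))"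
  unfolding word_grid_def cylindrical_grid_def pair_pre_digraph.simps
  by (intro sym_Un sym_symcl) (auto simp: sym_def)

lemma word_grid_vertical:
  assumes "1 \<le> i" "i < d" "1 \<le> j" "j \<le> length w"
  shows "((i, j), (Suc i, j)) \<in> parcs (word_grid d w)"
  using assms by (auto simp: word_grid_def cylindrical_grid_def symcl_def)

lemma word_grid_horizontal:
  assumes "1 \<le> i" "i \<le> d" "1 \<le> j" "j < length w"
  shows "((i, j), (i, Suc j)) \<in> parcs (word_grid d w)"
proof -
  have "Suc j = j mod length w + 1" using assms by simp
  then show ?thesis
    using assms by (fastforce simp: word_grid_def cylindrical_grid_def symcl_def)
qed

lemma word_grid_wrap:
  assumes "1 \<le> i" "i \<le> d" "w \<noteq> []"
  shows "((i, length w), (i, 1)) \<in> parcs (word_grid d w)"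
proof -
  have "1 = length w mod length w + 1" "length w \<in> {1..length w}"
    using assms by (auto simp: Suc_le_eq)
  then show ?thesis
    using assms unfolding word_grid_def cylindrical_grid_def symcl_def by fastforce
qed

lemma word_grid_chord:
  assumes "p < length w" "q < length w" "p \<noteq> q" "w ! p = w ! q" "w ! p \<noteq> 0"
  shows "((1, Suc p), (1, Suc q)) \<in> parcs (word_grid d w)"
  using assms by (auto simp: word_grid_def)

text \<open>As \<open>G\<close> is symmetric, one orientation per grid edge suffices. The closing
  edge of each cycle is split off so that the horizontal case can use \<open>Suc j\<close> without
  reduction modulo the length.\<close>

lemma word_grid_minorI:
  assumes d: "0 < d"
    and symG: "sym (parcs G)"
    and linked: "\<And>i j. 1 \<le> i \<Longrightarrow> i \<le> d \<Longrightarrow> 1 \<le> j \<Longrightarrow> j \<le> length w \<Longrightarrow>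
           \<mu> (i, j) \<subseteq> pverts G \<and> linked G (\<mu> (i, j))"
    and disj: "\<And>i j i' j' v. 1 \<le> i \<Longrightarrow> i \<le> d \<Longrightarrow> 1 \<le> j \<Longrightarrow> j \<le> length w \<Longrightarrow>
           1 \<le> i' \<Longrightarrow> i' \<le> d \<Longrightarrow> 1 \<le> j' \<Longrightarrow> j' \<le> length w \<Longrightarrow>
           v \<in> \<mu> (i, j) \<Longrightarrow> v \<in> \<mu> (i', j') \<Longrightarrow> i = i' \<and> j = j'"
    and vertical: "\<And>i j. 1 \<le> i \<Longrightarrow> i < d \<Longrightarrow> 1 \<le> j \<Longrightarrow> j \<le> length w \<Longrightarrow>
           \<exists>u\<in>\<mu> (i, j). \<exists>v\<in>\<mu> (Suc i, j). (u, v) \<in> parcs G"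
    and horizontal: "\<And>i j. 1 \<le> i \<Longrightarrow> i \<le> d \<Longrightarrow> 1 \<le> j \<Longrightarrow> j < length w \<Longrightarrow>
           \<exists>u\<in>\<mu> (i, j). \<exists>v\<in>\<mu> (i, Suc j). (u, v) \<in> parcs G"
    and wrap: "\<And>i. 1 \<le> i \<Longrightarrow> i \<le> d \<Longrightarrow> w \<noteq> [] \<Longrightarrow>
           \<exists>u\<in>\<mu> (i, length w). \<exists>v\<in>\<mu> (i, 1). (u, v) \<in> parcs G"
    and chord: "\<And>p q. p < length w \<Longrightarrow> q < length w \<Longrightarrow> p \<noteq> q \<Longrightarrow> w ! p = w ! q \<Longrightarrow> w ! p \<noteq> 0 \<Longrightarrow>
           \<exists>u\<in>\<mu> (1, Suc p). \<exists>v\<in>\<mu> (1, Suc q). (u, v) \<in> parcs G"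
  shows "is_minor (word_grid d w) G"
proof -
  let ?A = "\<lambda>x y. \<exists>u\<in>\<mu> x. \<exists>v\<in>\<mu> y. (u, v) \<in> parcs G"
  have sym: "?A x y \<Longrightarrow> ?A y x" for x y
    using symG by (meson symD)
  have hor: "?A (i, j) (i, j mod length w + 1)" if "1 \<le> i" "i \<le> d" "1 \<le> j" "j \<le> length w" for i j
  proof (cases "j = length w")
    case True
    then show ?thesis using wrap[of i] that by (cases "w = []") auto
  next
    case False
    then show ?thesis using horizontal[of i j] that by simp
  qed
  have "\<mu> x \<subseteq> pverts G \<and> linked G (\<mu> x)" if "x \<in> pverts (word_grid d w)" for x
    using that linked by (cases x) simp
  moreover have "\<mu> x \<inter> \<mu> y = {}"
    if "x \<in> pverts (word_grid d w)" "y \<in> pverts (word_grid d w)" "x \<noteq> y" for x y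
    using that disj by (cases x; cases y) (simp, blast)
  moreover have "?A x y" if "(x, y) \<in> parcs (word_grid d w)" for x y
  proof -
    have "(\<exists>i j. 1 \<le> i \<and> i \<le> d \<and> 1 \<le> j \<and> j \<le> length w \<and>
             ((x = (i, j) \<and> y = (i, j mod length w + 1)) \<or> (y = (i, j) \<and> x = (i, j mod length w + 1)))) \<or>
          (\<exists>i j. 1 \<le> i \<and> i < d \<and> 1 \<le> j \<and> j \<le> length w \<and>
             ((x = (i, j) \<and> y = (Suc i, j)) \<or> (y = (i, j) \<and> x = (Suc i, j)))) \<or>
          (\<exists>p q. p < length w \<and> q < length w \<and> p \<noteq> q \<and> w ! p = w ! q \<and> w ! p \<noteq> 0 \<and>
             x = (1, Suc p) \<and> y = (1, Suc q))"
      using that by (auto simp: word_grid_def cylindrical_grid_def symcl_def)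
    then show ?thesis
    proof (elim disjE exE conjE)
    qed (use hor vertical chord sym in \<open>simp_all del: One_nat_def\<close>)
  qed
  ultimately show ?thesis
    by (rule is_minorI[of _ \<mu>])
qed

text \<open>All chords lie on cycle 1, so the first \<open>d\<close> cycles of the deeper grid
  already form the model.\<close>

lemma word_grid_depth_minor:
  assumes "0 < d" "d \<le> e"
  shows "is_minor (word_grid d w) (word_grid e w)"
  by (rule word_grid_minorI[where \<mu> = "\<lambda>x. {x}"])
    (use assms in \<open>auto simp: sym_word_grid linked_singleton
       intro: word_grid_vertical word_grid_horizontal word_grid_wrap[unfolded One_nat_def] word_grid_chord[unfolded One_nat_def]\<close>)

lemma word_grid_minor_refl: "0 < d \<Longrightarrow> is_minor (word_grid d w) (word_grid d w)"
  by (rule word_grid_depth_minor) auto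

text \<open>The column of \<open>a\<close> is merged cycle by cycle into its left neighbour, which
  keeps the cycles closed while the chords at \<open>a\<close> are dropped. Since \<open>u\<close>
  is nonempty, this neighbour exists and column 1 stays in place.\<close>

lemma word_grid_delete_minor:
  assumes "u \<noteq> []" "0 < d"
  shows "is_minor (word_grid d (u @ v)) (word_grid d (u @ a # v))"
proof -
  let ?n = "length u" and ?G = "word_grid d (u @ a # v)"
  define \<sigma> where "\<sigma> j = (if j \<le> ?n then j else Suc j)" for j
  define \<mu> where "\<mu> = (\<lambda>(i::nat, j). if j = ?n then {(i, Suc j), (i, j)} else {(i, \<sigma> j)})"
  have mem: "(i, \<sigma> j) \<in> \<mu> (i, j)" for i j
    by (simp add: \<mu>_def \<sigma>_def)
  have hor: "((i, j), (i, Suc j)) \<in> parcs ?G"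
    if "1 \<le> i" "i \<le> d" "1 \<le> j" "j \<le> length (u @ v)" for i j
    using that by (intro word_grid_horizontal) auto
  show ?thesis
  proof (rule word_grid_minorI[where \<mu> = \<mu>])
    fix i j assume ij: "1 \<le> i" "i \<le> d" "1 \<le> j" "j \<le> length (u @ v)"
    then have "linked ?G {(i, Suc j), (i, j)}"
      by (intro linked_insert[OF linked_singleton]) (auto intro: hor)
    then show "\<mu> (i, j) \<subseteq> pverts ?G \<and> linked ?G (\<mu> (i, j))"
      using ij by (auto simp: \<mu>_def \<sigma>_def linked_singleton)
  next
    fix i j i' j' x
    assume "x \<in> \<mu> (i, j)" "x \<in> \<mu> (i', j')"
    then show "i = i' \<and> j = j'"
      by (auto simp: \<mu>_def \<sigma>_def split: if_splits)
  next
    fix i j assume "1 \<le> i" "i < d" "1 \<le> j" "j \<le> length (u @ v)"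
    then have "((i, \<sigma> j), (Suc i, \<sigma> j)) \<in> parcs ?G"
      by (intro word_grid_vertical) (auto simp: \<sigma>_def)
    then show "\<exists>x\<in>\<mu> (i, j). \<exists>y\<in>\<mu> (Suc i, j). (x, y) \<in> parcs ?G"
      using mem by blast
  next
    fix i j assume ij: "1 \<le> i" "i \<le> d" "1 \<le> j" "j < length (u @ v)"
    \<comment> \<open>The last column of the branch set of \<open>j\<close>; the edge to the next
      branch set leaves from there.\<close>
    define j' where "j' = (if j = ?n then Suc j else \<sigma> j)"
    have "((i, j'), (i, Suc j')) \<in> parcs ?G"
      using ij by (intro word_grid_horizontal) (auto simp: j'_def \<sigma>_def)
    moreover have "(i, j') \<in> \<mu> (i, j)" "Suc j' = \<sigma> (Suc j)"
      by (auto simp: \<mu>_def j'_def \<sigma>_def)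
    ultimately show "\<exists>x\<in>\<mu> (i, j). \<exists>y\<in>\<mu> (i, Suc j). (x, y) \<in> parcs ?G"
      using mem by metis
  next
    fix i assume "1 \<le> i" "i \<le> d"
    then have "((i, length (u @ a # v)), (i, 1)) \<in> parcs ?G"
      by (intro word_grid_wrap) auto
    moreover have "(i, length (u @ a # v)) \<in> \<mu> (i, length (u @ v))"
      by (auto simp: \<mu>_def \<sigma>_def)
    moreover have "(i, 1) \<in> \<mu> (i, 1)"
      using assms by (cases u) (auto simp: \<mu>_def \<sigma>_def)
    ultimately show "\<exists>x\<in>\<mu> (i, length (u @ v)). \<exists>y\<in>\<mu> (i, 1). (x, y) \<in> parcs ?G"
      by blast
  next
    fix p q
    assume pq: "p < length (u @ v)" "q < length (u @ v)" "p \<noteq> q" "(u @ v) ! p = (u @ v) ! q" "(u @ v) ! p \<noteq> 0"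
    \<comment> \<open>The counterpart of \<open>\<sigma>\<close> for word positions, which count
      from 0 while columns count from 1.\<close>
    define s where "s p = (if p < ?n then p else Suc p)" for p
    have s: "(u @ a # v) ! s p = (u @ v) ! p" "s p < length (u @ a # v) \<longleftrightarrow> p < length (u @ v)" "\<sigma> (Suc p) = Suc (s p)" for p
      by (auto simp: s_def \<sigma>_def nth_append nth_Cons')
    have "s p \<noteq> s q"
      using pq by (auto simp: s_def)
    then have "((1, \<sigma> (Suc p)), (1, \<sigma> (Suc q))) \<in> parcs ?G"
      using pq unfolding s(3) by (intro word_grid_chord) (simp_all only: s not_False_eq_True)
    then show "\<exists>x\<in>\<mu> (1, Suc p). \<exists>y\<in>\<mu> (1, Suc q). (x, y) \<in> parcs ?G"
      using mem by blast
  qed (use assms sym_word_grid in auto)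
qed

text \<open>The prefix \<open>u\<close> is generalised in the induction: a kept letter moves into
  it, so every later deletion again has a nonempty prefix.\<close>

lemma word_grid_subseq_minor:
  assumes "subseq v' v" "u \<noteq> []" "0 < d"
  shows "is_minor (word_grid d (u @ v')) (word_grid d (u @ v))"
  using assms
proof (induction arbitrary: u rule: list_emb.induct)
  case (list_emb_Nil ys)
  then show ?case
  proof (induction ys)
    case (Cons y ys)
    then show ?case
      using is_minor_trans word_grid_delete_minor by blast
  qed (simp add: word_grid_minor_refl)
next
  case (list_emb_Cons xs ys y)
  then show ?case
    using is_minor_trans word_grid_delete_minor by blast
next
  case (list_emb_Cons2 x y xs ys)
  then show ?case
    using list_emb_Cons2.IH[of "u @ [x]"] by simp
qed

text \<open>
  The branch set of column \<open>x\<close> absorbs the two joined vertices of row 1, so it reaches the partners of \<open>b\<close>.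
\<close>

lemma word_grid_join_minor:
  assumes d: "0 < d"
    and less: "q < length w" "r < length w" "x < length w"
    and consec: "r = Suc q \<or> q = Suc r"
    and x: "x \<noteq> q" "x \<noteq> r"
    and a: "w ! q = a" "w ! x = a" "a \<noteq> 0"
    and b: "w ! r = b" "b \<noteq> a" "b \<noteq> 0"
    and once: "\<And>p. p < length w \<Longrightarrow> w ! p = a \<Longrightarrow> p = q \<or> p = x"
  shows "is_minor (word_grid d (w[q := 0, r := 0, x := b])) (word_grid (Suc d) w)"
proof -
  let ?w = "w[q := 0, r := 0, x := b]" and ?G = "word_grid (Suc d) w"
  \<comment> \<open>Row \<open>i\<close> of the model lives in row \<open>i + 1\<close> of the grid;
    row 1 of the model also takes the vertices of grid row 1, where the chords end. The row 1
    vertices of the columns of \<open>q\<close> and \<open>r\<close> go to the branch set of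
    \<open>x\<close> instead, so those two columns lose their chords. This is the cycle that the
    join costs.\<close>
  define \<mu> where "\<mu> = (\<lambda>(i::nat, j). if i = 1 \<and> j = Suc x then {(1, Suc r), (1, Suc q), (1, j), (2, j)}
     else if i = 1 \<and> j \<noteq> Suc q \<and> j \<noteq> Suc r then {(1, j), (2, j)} else {(Suc i, j)})"
  have mem: "(Suc i, j) \<in> \<mu> (i, j)" for i j
    by (auto simp: \<mu>_def numeral_2_eq_2)
  have mem1: "(1, j) \<in> \<mu> (1, j)" if "j \<noteq> Suc q" "j \<noteq> Suc r" for j
    using that by (auto simp: \<mu>_def)
  have memr: "(1, Suc r) \<in> \<mu> (1, Suc x)"
    by (auto simp: \<mu>_def)
  have vert: "linked ?G {(1, j), (2, j)}" if "1 \<le> j" "j \<le> length w" for j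
    using that d word_grid_vertical[of 1 "Suc d" j w]
    by (intro linked_insert[OF linked_singleton]) (auto simp: numeral_2_eq_2)
  have "((1, Suc x), (1, Suc q)) \<in> parcs ?G"
    using a x less by (intro word_grid_chord) auto
  then have "linked ?G {(1, Suc q), (1, Suc x), (2, Suc x)}"
    using less by (intro linked_insert[OF vert insertI1]) auto
  moreover have "((1, Suc r), (1, Suc q)) \<in> parcs ?G \<or> ((1, Suc q), (1, Suc r)) \<in> parcs ?G"
    using consec less word_grid_horizontal[of 1 "Suc d" "Suc q" w] word_grid_horizontal[of 1 "Suc d" "Suc r" w]
    by auto
  ultimately have linkx: "linked ?G {(1, Suc r), (1, Suc q), (1, Suc x), (2, Suc x)}"
    by (rule linked_insert[OF _ insertI1])
  have nth: "?w ! p = (if p = x then b else if p = q \<or> p = r then 0 else w ! p)" if "p < length w" for p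
    using that x consec less by (auto simp: nth_list_update)
  have chord: "\<exists>u\<in>\<mu> (1, Suc p). \<exists>v\<in>\<mu> (1, Suc p'). (u, v) \<in> parcs ?G"
    if pp: "p < length w" "p' < length w" "p \<noteq> p'" "?w ! p = ?w ! p'" "?w ! p \<noteq> 0" "p' \<noteq> x" for p p'
  proof -
    from pp have p': "p' \<noteq> q" "p' \<noteq> r" "w ! p' = ?w ! p" and p: "p \<noteq> q" "p \<noteq> r"
      using nth[of p] nth[of p'] x by (auto split: if_splits)
    then have "(1, Suc p') \<in> \<mu> (1, Suc p')"
      by (intro mem1) auto
    moreover have "\<exists>u\<in>\<mu> (1, Suc p). (u, (1, Suc p')) \<in> parcs ?G"
    proof (cases "p = x")
      case True
      then have "((1, Suc r), (1, Suc p')) \<in> parcs ?G"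
        using pp p' b less nth[of p] by (intro word_grid_chord) auto
      with True memr show ?thesis by blast
    next
      case False
      then have "((1, Suc p), (1, Suc p')) \<in> parcs ?G"
        using pp p p' nth[of p] by (intro word_grid_chord) auto
      with p mem1[of "Suc p"] show ?thesis by blast
    qed
    ultimately show ?thesis by blast
  qed
  show ?thesis
  proof (rule word_grid_minorI[where \<mu> = \<mu>])
    fix i j assume ij: "1 \<le> i" "i \<le> d" "1 \<le> j" "j \<le> length ?w"
    then show "\<mu> (i, j) \<subseteq> pverts ?G \<and> linked ?G (\<mu> (i, j))"
      using less d linkx vert[of j]
      by (cases "i = 1"; cases "j = Suc x") (auto simp: \<mu>_def linked_singleton)
  next
    fix i j i' j' v
    assume "1 \<le> i" "1 \<le> i'" "v \<in> \<mu> (i, j)" "v \<in> \<mu> (i', j')"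
    then show "i = i' \<and> j = j'"
      using x by (auto simp: \<mu>_def split: if_splits)
  next
    fix i j assume "1 \<le> i" "i < d" "1 \<le> j" "j \<le> length ?w"
    then have "((Suc i, j), (Suc (Suc i), j)) \<in> parcs ?G"
      by (intro word_grid_vertical) auto
    then show "\<exists>u\<in>\<mu> (i, j). \<exists>v\<in>\<mu> (Suc i, j). (u, v) \<in> parcs ?G"
      using mem by blast
  next
    fix i j assume "1 \<le> i" "i \<le> d" "1 \<le> j" "j < length ?w"
    then have "((Suc i, j), (Suc i, Suc j)) \<in> parcs ?G"
      by (intro word_grid_horizontal) auto
    then show "\<exists>u\<in>\<mu> (i, j). \<exists>v\<in>\<mu> (i, Suc j). (u, v) \<in> parcs ?G"
      using mem by blast
  next
    fix i assume "1 \<le> i" "i \<le> d" "?w \<noteq> []"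
    then have "((Suc i, length w), (Suc i, 1)) \<in> parcs ?G"
      by (intro word_grid_wrap) auto
    then show "\<exists>u\<in>\<mu> (i, length ?w). \<exists>v\<in>\<mu> (i, 1). (u, v) \<in> parcs ?G"
      using mem[of i "length w"] mem[of i 1] by auto
  next
    fix p p'
    assume pp: "p < length ?w" "p' < length ?w" "p \<noteq> p'" "?w ! p = ?w ! p'" "?w ! p \<noteq> 0"
    show "\<exists>u\<in>\<mu> (1, Suc p). \<exists>v\<in>\<mu> (1, Suc p'). (u, v) \<in> parcs ?G"
    \<comment> \<open>\<open>chord\<close> wants the second end to differ from \<open>x\<close>. At
      most one of \<open>p\<close>, \<open>p'\<close> is \<open>x\<close>, so symmetry settles the
      other orientation.\<close>
    proof (cases "p' = x")
      case True
      then have "\<exists>u\<in>\<mu> (1, Suc p'). \<exists>v\<in>\<mu> (1, Suc p). (u, v) \<in> parcs ?G"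
        using pp by (intro chord) auto
      then show ?thesis
        using sym_word_grid by (meson symD)
    next
      case False
      with pp show ?thesis
        by (intro chord) (simp_all only: length_list_update not_False_eq_True)
    qed
  qed (use d sym_word_grid in auto)
qed

section \<open>Sliding blocks along strips\<close>

text \<open>In this and the next three lemmas, \<open>left\<close> and \<open>right\<close> tell on
  which side of the other \<open>a\<close> the joined pair lies, \<open>before\<close> and
  \<open>after\<close> whether \<open>a\<close> comes first or second in the pair. The pair turns
  into two zeros, which are deleted, and \<open>b\<close> takes the place of the other
  \<open>a\<close>.\<close>

lemma join_left_before:
  assumes "0 < d" "L \<noteq> []" "a \<notin> set (L @ M @ N)" "b \<noteq> a" "a \<noteq> 0" "b \<noteq> 0"
  shows "is_minor (word_grid d (L @ M @ [b] @ N)) (word_grid (Suc d) (L @ [a, b] @ M @ [a] @ N))"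
proof (rule is_minor_trans)
  let ?w = "L @ [a, b] @ M @ [a] @ N" and ?q = "length L" and ?x = "length L + length M + 2"
  show "is_minor (word_grid d (?w[?q := 0, Suc ?q := 0, ?x := b])) (word_grid (Suc d) ?w)"
    by (rule word_grid_join_minor[where a = a])
      (use assms in \<open>auto simp: nth_append nth_Cons' split: if_splits dest: nth_mem\<close>)
  have "?w[?q := 0, Suc ?q := 0, ?x := b] = L @ [0, 0] @ M @ [b] @ N"
    by (simp add: list_update_append split: nat.split)
  then show "is_minor (word_grid d (L @ M @ [b] @ N)) (word_grid d (?w[?q := 0, Suc ?q := 0, ?x := b]))"
    using assms by (auto intro!: word_grid_subseq_minor)
qed

lemma join_left_after:
  assumes "0 < d" "L \<noteq> []" "a \<notin> set (L @ M @ N)" "b \<noteq> a" "a \<noteq> 0" "b \<noteq> 0"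
  shows "is_minor (word_grid d (L @ M @ [b] @ N)) (word_grid (Suc d) (L @ [b, a] @ M @ [a] @ N))"
proof (rule is_minor_trans)
  let ?w = "L @ [b, a] @ M @ [a] @ N" and ?q = "length L" and ?x = "length L + length M + 2"
  show "is_minor (word_grid d (?w[Suc ?q := 0, ?q := 0, ?x := b])) (word_grid (Suc d) ?w)"
    by (rule word_grid_join_minor[where a = a])
      (use assms in \<open>auto simp: nth_append nth_Cons' split: if_splits dest: nth_mem\<close>)
  have "?w[Suc ?q := 0, ?q := 0, ?x := b] = L @ [0, 0] @ M @ [b] @ N"
    by (simp add: list_update_append split: nat.split)
  then show "is_minor (word_grid d (L @ M @ [b] @ N)) (word_grid d (?w[Suc ?q := 0, ?q := 0, ?x := b]))"
    using assms by (auto intro!: word_grid_subseq_minor)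
qed

lemma join_right_before:
  assumes "0 < d" "L \<noteq> []" "a \<notin> set (L @ M @ N)" "b \<noteq> a" "a \<noteq> 0" "b \<noteq> 0"
  shows "is_minor (word_grid d (L @ [b] @ M @ N)) (word_grid (Suc d) (L @ [a] @ M @ [a, b] @ N))"
proof (rule is_minor_trans)
  let ?w = "L @ [a] @ M @ [a, b] @ N" and ?x = "length L" and ?q = "length L + length M + 1"
  show "is_minor (word_grid d (?w[?q := 0, Suc ?q := 0, ?x := b])) (word_grid (Suc d) ?w)"
    by (rule word_grid_join_minor[where a = a])
      (use assms in \<open>auto simp: nth_append nth_Cons' split: if_splits dest: nth_mem\<close>)
  have "?w[?q := 0, Suc ?q := 0, ?x := b] = (L @ [b] @ M) @ [0, 0] @ N"
    by (simp add: list_update_append split: nat.split)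
  then show "is_minor (word_grid d (L @ [b] @ M @ N)) (word_grid d (?w[?q := 0, Suc ?q := 0, ?x := b]))"
    using assms word_grid_subseq_minor[of N "[0, 0] @ N" "L @ [b] @ M" d] by auto
qed

lemma join_right_after:
  assumes "0 < d" "L \<noteq> []" "a \<notin> set (L @ M @ N)" "b \<noteq> a" "a \<noteq> 0" "b \<noteq> 0"
  shows "is_minor (word_grid d (L @ [b] @ M @ N)) (word_grid (Suc d) (L @ [a] @ M @ [b, a] @ N))"
proof (rule is_minor_trans)
  let ?w = "L @ [a] @ M @ [b, a] @ N" and ?x = "length L" and ?q = "length L + length M + 1"
  show "is_minor (word_grid d (?w[Suc ?q := 0, ?q := 0, ?x := b])) (word_grid (Suc d) ?w)"
    by (rule word_grid_join_minor[where a = a])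
      (use assms in \<open>auto simp: nth_append nth_Cons' split: if_splits dest: nth_mem\<close>)
  have "?w[Suc ?q := 0, ?q := 0, ?x := b] = (L @ [b] @ M) @ [0, 0] @ N"
    by (simp add: list_update_append split: nat.split)
  then show "is_minor (word_grid d (L @ [b] @ M @ N)) (word_grid d (?w[Suc ?q := 0, ?q := 0, ?x := b]))"
    using assms word_grid_subseq_minor[of N "[0, 0] @ N" "L @ [b] @ M" d] by auto
qed

text \<open>The last letter of \<open>x\<close> meets the first letter of \<open>Y\<close>; joining
  them puts the latter at the end of the second copy of \<open>x\<close>. The next letter lands in
  front of it, so \<open>Y\<close> arrives reversed. Each letter of \<open>Y\<close> consumes one
  edge of the strip and one cycle.\<close>

lemma slide_left_before:
  assumes "0 < d" "U \<noteq> []" "length x = length Y" "distinct x"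
    and "set x \<inter> set (U @ Y @ V @ Q) = {}" "0 \<notin> set x" "0 \<notin> set Y"
  shows "is_minor (word_grid d (U @ V @ rev Y @ Q)) (word_grid (d + length Y) (U @ x @ Y @ V @ x @ Q))"
  using assms
proof (induction Y arbitrary: x Q)
  case (Cons b Y)
  then obtain x' a where x: "x = x' @ [a]"
    by (cases x rule: rev_cases) auto
  have "is_minor (word_grid (d + length Y) ((U @ x') @ (Y @ V @ x') @ [b] @ Q))
          (word_grid (Suc (d + length Y)) ((U @ x') @ [a, b] @ (Y @ V @ x') @ [a] @ Q))"
    using Cons.prems x by (intro join_left_before) auto
  moreover have "is_minor (word_grid d (U @ V @ rev Y @ (b # Q)))
          (word_grid (d + length Y) (U @ x' @ Y @ V @ x' @ (b # Q)))"
    using Cons.prems x by (intro Cons.IH) auto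
  ultimately show ?case
    using x by (auto intro: is_minor_trans)
qed (simp add: word_grid_minor_refl)

text \<open>Now the last letter of \<open>Y\<close> meets the first letter of \<open>x\<close> and
  lands at the front of the second copy. The strip is consumed from its other end, and the moved
  letters are collected in \<open>V\<close> during the induction.\<close>

lemma slide_left_after:
  assumes "0 < d" "U \<noteq> []" "length x = length Y" "distinct x"
    and "set x \<inter> set (U @ Y @ V @ Q) = {}" "0 \<notin> set x" "0 \<notin> set Y"
  shows "is_minor (word_grid d (U @ V @ rev Y @ Q)) (word_grid (d + length Y) (U @ Y @ x @ V @ x @ Q))"
  using assms
proof (induction Y arbitrary: x V rule: rev_induct)
  case (snoc b Y)
  then obtain x' a where x: "x = a # x'"
    by (cases x) auto
  have "is_minor (word_grid (d + length Y) ((U @ Y) @ (x' @ V) @ [b] @ (x' @ Q)))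
          (word_grid (Suc (d + length Y)) ((U @ Y) @ [b, a] @ (x' @ V) @ [a] @ (x' @ Q)))"
    using snoc.prems x by (intro join_left_after) auto
  moreover have "is_minor (word_grid d (U @ (V @ [b]) @ rev Y @ Q))
          (word_grid (d + length Y) (U @ Y @ x' @ (V @ [b]) @ x' @ Q))"
    using snoc.prems x by (intro snoc.IH) auto
  ultimately show ?case
    using x by (auto intro: is_minor_trans)
qed (simp add: word_grid_minor_refl)

text \<open>The form of \<open>slide_left_after\<close> for the word read backwards:
  \<open>Y\<close> stands outside the two copies and moves to the first one.\<close>

lemma slide_right_after:
  assumes "0 < d" "U \<noteq> []" "length x = length Y" "distinct x"
    and "set x \<inter> set (U @ Y @ V @ Q) = {}" "0 \<notin> set x" "0 \<notin> set Y"
  shows "is_minor (word_grid d (U @ rev Y @ V @ Q)) (word_grid (d + length Y) (U @ x @ V @ x @ Y @ Q))"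
  using assms
proof (induction Y arbitrary: x V)
  case (Cons b Y)
  then obtain x' a where x: "x = x' @ [a]"
    by (cases x rule: rev_cases) auto
  have "is_minor (word_grid (d + length Y) ((U @ x') @ [b] @ (V @ x') @ (Y @ Q)))
          (word_grid (Suc (d + length Y)) ((U @ x') @ [a] @ (V @ x') @ [a, b] @ (Y @ Q)))"
    using Cons.prems x by (intro join_right_before) auto
  moreover have "is_minor (word_grid d (U @ rev Y @ (b # V) @ Q))
          (word_grid (d + length Y) (U @ x' @ (b # V) @ x' @ Y @ Q))"
    using Cons.prems x by (intro Cons.IH) auto
  ultimately show ?case
    using x by (auto intro: is_minor_trans)
qed (simp add: word_grid_minor_refl)

text \<open>The form of \<open>slide_left_before\<close> for the word read backwards:
  \<open>Y\<close> stands between the two copies and moves from the second to the first.\<close>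

lemma slide_right_before:
  assumes "0 < d" "U \<noteq> []" "length x = length Y" "distinct x"
    and "set x \<inter> set (U @ Y @ V @ Q) = {}" "0 \<notin> set x" "0 \<notin> set Y"
  shows "is_minor (word_grid d (U @ rev Y @ V @ Q)) (word_grid (d + length Y) (U @ x @ V @ Y @ x @ Q))"
  using assms
proof (induction Y arbitrary: x U rule: rev_induct)
  case (snoc b Y)
  then obtain x' a where x: "x = a # x'"
    by (cases x) auto
  have "is_minor (word_grid (d + length Y) (U @ [b] @ (x' @ V @ Y) @ (x' @ Q)))
          (word_grid (Suc (d + length Y)) (U @ [a] @ (x' @ V @ Y) @ [b, a] @ (x' @ Q)))"
    using snoc.prems x by (intro join_right_after) auto
  moreover have "is_minor (word_grid d ((U @ [b]) @ rev Y @ V @ Q))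
          (word_grid (d + length Y) ((U @ [b]) @ x' @ V @ Y @ x' @ Q))"
    using snoc.prems x by (intro snoc.IH) auto
  ultimately show ?case
    using x by (auto intro: is_minor_trans)
qed (simp add: word_grid_minor_refl)

section \<open>Surface grids as word grids\<close>

text \<open>\<open>True\<close> stands for a handle and \<open>False\<close> for a crosscap.\<close>

definition block :: "bool \<Rightarrow> nat list \<Rightarrow> nat list" where
  "block t X = (if t then
     let A = take (length X div 2) X; B = drop (length X div 2) X in A @ B @ rev A @ rev B
   else X @ X)"

abbreviation blocks :: "(bool \<times> nat list) list \<Rightarrow> nat list" where
  "blocks rs \<equiv> concat (map (case_prod block) rs)"

text \<open>The zeros are position 1 of the surface grid, which never receives a handle or a
  crosscap. They also provide the nonempty prefix that the deletion and sliding lemmas ask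
  for.\<close>

definition surface_word :: "nat \<Rightarrow> (bool \<times> nat list) list \<Rightarrow> nat list" where
  "surface_word k rs = replicate (4 * k) 0 @ blocks rs"

text \<open>A crosscap has one strip of \<open>2 * k\<close> edges, a handle two strips of
  \<open>k\<close> edges stored one after the other. Including 0 in the distinct list makes all
  letters nonzero as well as pairwise different across blocks.\<close>

definition ribbons :: "nat \<Rightarrow> (bool \<times> nat list) list \<Rightarrow> bool" where
  "ribbons k rs \<longleftrightarrow> (\<forall>r\<in>set rs. length (snd r) = 2 * k) \<and> distinct (0 # concat (map snd rs))"

text \<open>List indices start at 0 and position 1 stays free, hence the shift by 2.\<close>

definition typed_grid :: "nat \<Rightarrow> bool list \<Rightarrow> (nat \<times> nat) pair_pre_digraph" where
  "typed_grid k ts = surface_grid k (length ts + 1)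
     {i + 2 | i. i < length ts \<and> ts ! i} {i + 2 | i. i < length ts \<and> \<not> ts ! i}"

lemma set_block [simp]: "set (block t X) = set X"
proof -
  have "set X = set (take (length X div 2) X) \<union> set (drop (length X div 2) X)"
    by (metis append_take_drop_id set_append)
  then show ?thesis
    by (auto simp: block_def Let_def)
qed

lemma length_block: "even (length X) \<Longrightarrow> length (block t X) = 2 * length X"
  by (auto simp: block_def Let_def elim!: evenE)

lemma block_handle_eq_iff:
  assumes X: "distinct X" "length X = 2 * m" and r: "r < r'" "r' < 4 * m"
  shows "block True X ! r = block True X ! r' \<longleftrightarrow>
    r < m \<and> r' = 3 * m - 1 - r \<or> m \<le> r \<and> r < 2 * m \<and> r' = 5 * m - 1 - r"
proof -
  \<comment> \<open>The index in \<open>X\<close> of the letter at place \<open>r\<close>: the last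
    two quarters of the block read the two halves of \<open>X\<close> backwards.\<close>
  define \<phi> where "\<phi> r = (if r < 2 * m then r else if r < 3 * m then 3 * m - 1 - r else 5 * m - 1 - r)" for r
  have nth: "block True X ! r = X ! \<phi> r" if "r < 4 * m" for r
  proof -
    have "m - Suc (r - 2 * m) = 3 * m - 1 - r" if "2 * m \<le> r" using that by simp
    moreover have "m + (m - Suc (r - 3 * m)) = 5 * m - 1 - r" if "3 * m \<le> r" using that \<open>r < 4 * m\<close> by simp
    moreover have "r - m - m - m = r - 3 * m" "r - m - m = r - 2 * m" by simp_all
    ultimately show ?thesis
      using X that by (auto simp: block_def Let_def \<phi>_def nth_append rev_nth)
  qed
  have "\<phi> r < length X" if "r < 4 * m" for r
    using X that by (auto simp: \<phi>_def)
  then have "X ! \<phi> r = X ! \<phi> r' \<longleftrightarrow> \<phi> r = \<phi> r'"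
    using r nth_eq_iff_index_eq[OF X(1)] by simp
  then show ?thesis
    using r by (simp add: nth) (auto simp: \<phi>_def split: if_splits)
qed

lemma block_crosscap_eq_iff:
  assumes X: "distinct X" "length X = 2 * m" and r: "r < r'" "r' < 4 * m"
  shows "block False X ! r = block False X ! r' \<longleftrightarrow> r < 2 * m \<and> r' = r + 2 * m"
proof -
  have "X ! i = X ! j \<longleftrightarrow> i = j" if "i < 2 * m" "j < 2 * m" for i j
    using that X nth_eq_iff_index_eq[OF X(1)] by simp
  then show ?thesis
    using X r by (auto simp: block_def nth_append)
qed

text \<open>Offsets inside a position now count from 0, and the condition has the shape of
  \<open>block_handle_eq_iff\<close>, so that edges and equal letters can be matched by
  rewriting.\<close>

lemma handle_edges_alt:
  "handle_edges m (i + 2) = {((1, 4 * m * (i + 1) + r + 1), (1, 4 * m * (i + 1) + r' + 1)) | r r'.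
     r < r' \<and> r' < 4 * m \<and> (r < m \<and> r' = 3 * m - 1 - r \<or> m \<le> r \<and> r < 2 * m \<and> r' = 5 * m - 1 - r)}"
  (is "_ = ?R")
proof (intro equalityI subrelI)
  fix x y
  assume "(x, y) \<in> handle_edges m (i + 2)"
  then consider j where "1 \<le> j" "j \<le> m" "x = (1, 4*m*(i+1) + j)" "y = (1, 4*m*(i+1) + 3*m - j + 1)"
    | j where "1 \<le> j" "j \<le> m" "x = (1, 4*m*(i+1) + m + j)" "y = (1, 4*m*(i+1) + 4*m - j + 1)"
    by (auto simp: handle_edges_def)
  then show "(x, y) \<in> ?R"
  proof cases
    case 1
    then have "x = (1, 4 * m * (i + 1) + (j - 1) + 1)" "y = (1, 4 * m * (i + 1) + (3 * m - j) + 1)"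
      by auto
    with 1(1,2) show ?thesis
      by (intro CollectI exI[of _ "j - 1"] exI[of _ "3 * m - j"]) auto
  next
    case 2
    then have "x = (1, 4 * m * (i + 1) + (m + j - 1) + 1)" "y = (1, 4 * m * (i + 1) + (4 * m - j) + 1)"
      by auto
    with 2(1,2) show ?thesis
      by (intro CollectI exI[of _ "m + j - 1"] exI[of _ "4 * m - j"]) auto
  qed
next
  fix x y
  assume "(x, y) \<in> ?R"
  then obtain r r' where r: "x = (1, 4 * m * (i + 1) + r + 1)" "y = (1, 4 * m * (i + 1) + r' + 1)"
    "r < m \<and> r' = 3 * m - 1 - r \<or> m \<le> r \<and> r < 2 * m \<and> r' = 5 * m - 1 - r"
    by auto
  from r(3) show "(x, y) \<in> handle_edges m (i + 2)"
  proof
    assume "r < m \<and> r' = 3 * m - 1 - r"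
    then show ?thesis
      using r(1,2) by (auto simp: handle_edges_def intro!: exI[of _ "r + 1"] disjI1)
  next
    assume "m \<le> r \<and> r < 2 * m \<and> r' = 5 * m - 1 - r"
    then show ?thesis
      using r(1,2) by (auto simp: handle_edges_def intro!: exI[of _ "r + 1 - m"] disjI2)
  qed
qed

lemma crosscap_edges_alt:
  "crosscap_edges m (i + 2) = {((1, 4 * m * (i + 1) + r + 1), (1, 4 * m * (i + 1) + r' + 1)) | r r'.
     r < r' \<and> r' < 4 * m \<and> r < 2 * m \<and> r' = r + 2 * m}"
  (is "_ = ?R")
proof (intro equalityI subrelI)
  fix x y
  assume "(x, y) \<in> crosscap_edges m (i + 2)"
  then obtain j where "1 \<le> j" "j \<le> 2 * m" "x = (1, 4*m*(i+1) + j)" "y = (1, 4*m*(i+1) + 2*m + j)"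
    by (auto simp: crosscap_edges_def)
  then show "(x, y) \<in> ?R"
    by (simp, intro exI[of _ "j - 1"]) auto
next
  fix x y
  assume "(x, y) \<in> ?R"
  then show "(x, y) \<in> crosscap_edges m (i + 2)"
    by (force simp: crosscap_edges_def)
qed

lemma length_surface_word:
  assumes "ribbons k rs"
  shows "length (surface_word k rs) = (length rs + 1) * (4 * k)"
proof -
  have "length (blocks rs) = 4 * k * length (map (case_prod block) rs)"
    using assms by (intro length_concat_uniform) (auto simp: ribbons_def length_block)
  then show ?thesis
    by (simp add: surface_word_def algebra_simps)
qed

lemma surface_word_nth:
  assumes "ribbons k rs" "i < length rs" "r < 4 * k"
  shows "surface_word k rs ! (4 * k * (i + 1) + r) = block (fst (rs ! i)) (snd (rs ! i)) ! r"
proof -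
  have "concat (replicate (4 * k) 0 # map (case_prod block) rs) ! (4 * k * (i + 1) + r) =
      (replicate (4 * k) 0 # map (case_prod block) rs) ! (i + 1) ! r"
    using assms by (intro nth_concat_uniform) (auto simp: ribbons_def length_block)
  then show ?thesis
    using assms by (simp add: surface_word_def case_prod_beta)
qed

text \<open>The graphs are equal, not only isomorphic: offset \<open>r\<close> of position
  \<open>i + 2\<close> is word place \<open>4 * k * (i + 1) + r\<close>. Equal nonzero letters occur
  only within one block, where the block lemmas turn them into handle or crosscap edges.\<close>

lemma typed_grid_eq_word_grid:
  assumes rs: "ribbons k rs"
  shows "typed_grid k (map fst rs) = word_grid k (surface_word k rs)"
proof -
  let ?w = "surface_word k rs" and ?N = "length rs"
  let ?blk = "\<lambda>i. block (fst (rs ! i)) (snd (rs ! i))"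
  define E where "E = (\<Union>i<?N. {((1::nat, 4 * k * (i + 1) + r + 1), (1::nat, 4 * k * (i + 1) + r' + 1)) | r r'.
     r < r' \<and> r' < 4 * k \<and> ?blk i ! r = ?blk i ! r'})"
  have X: "distinct (snd (rs ! i))" "length (snd (rs ! i)) = 2 * k" "0 \<notin> set (snd (rs ! i))" if "i < ?N" for i
    using rs that by (force simp: ribbons_def distinct_concat_iff in_set_conv_nth)+
  have edges: "(if fst (rs ! i) then handle_edges k (i + 2) else crosscap_edges k (i + 2)) =
      {((1::nat, 4 * k * (i + 1) + r + 1), (1::nat, 4 * k * (i + 1) + r' + 1)) | r r'.
        r < r' \<and> r' < 4 * k \<and> ?blk i ! r = ?blk i ! r'}" if "i < ?N" for i
    unfolding handle_edges_alt crosscap_edges_alt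
    using block_handle_eq_iff[OF X(1,2)[OF that]] block_crosscap_eq_iff[OF X(1,2)[OF that]]
    by (cases "fst (rs ! i)") (simp_all only: if_True if_False cong: conj_cong)
  have positions: "{i + 2 | i. i < ?N \<and> map fst rs ! i} = (\<lambda>i. i + 2) ` {i. i < ?N \<and> fst (rs ! i)}"
    "{i + 2 | i. i < ?N \<and> \<not> map fst rs ! i} = (\<lambda>i. i + 2) ` {i. i < ?N \<and> \<not> fst (rs ! i)}"
    by auto
  have "(\<Union>i\<in>{i + 2 | i. i < ?N \<and> map fst rs ! i}. handle_edges k i) \<union>
      (\<Union>i\<in>{i + 2 | i. i < ?N \<and> \<not> map fst rs ! i}. crosscap_edges k i) =
    (\<Union>i<?N. if fst (rs ! i) then handle_edges k (i + 2) else crosscap_edges k (i + 2))"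
    unfolding positions UN_simps by (auto split: if_splits)
  also have "\<dots> = E"
    unfolding E_def using edges by (intro SUP_cong refl) (simp only: lessThan_iff)
  finally have E: "(\<Union>i\<in>{i + 2 | i. i < ?N \<and> map fst rs ! i}. handle_edges k i) \<union>
      (\<Union>i\<in>{i + 2 | i. i < ?N \<and> \<not> map fst rs ! i}. crosscap_edges k i) = E" .
  \<comment> \<open>The first \<open>4 * k\<close> places carry 0, so a place with a nonzero letter
    has quotient at least 1 by \<open>4 * k\<close>; hence the index \<open>i + 1\<close>.\<close>
  have decomp: "\<exists>i r. p = 4 * k * (i + 1) + r \<and> i < ?N \<and> r < 4 * k \<and> ?w ! p \<in> set (snd (rs ! i))"
    if p: "p < length ?w" "?w ! p \<noteq> 0" for p
  proof -
    have "4 * k \<le> p"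
      using p(2) by (cases "p < 4 * k") (auto simp: surface_word_def nth_append)
    have "k \<noteq> 0"
      using p(1) rs by (cases k) (auto simp: length_surface_word)
    with \<open>4 * k \<le> p\<close> have "p div (4 * k) \<noteq> 0"
      by (simp add: div_eq_0_iff)
    moreover have "p div (4 * k) < ?N + 1"
      using p(1) rs by (simp add: length_surface_word less_mult_imp_div_less)
    ultimately obtain i where i: "p div (4 * k) = i + 1" "i < ?N"
      by (cases "p div (4 * k)") auto
    moreover have r: "p = 4 * k * (i + 1) + p mod (4 * k)" "p mod (4 * k) < 4 * k"
      using i(1) \<open>k \<noteq> 0\<close> mult_div_mod_eq[of "4 * k" p] by simp_all
    moreover have "?w ! p = ?blk i ! (p mod (4 * k))"
      using surface_word_nth[OF rs i(2) r(2)] r(1) by simp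
    moreover have "?blk i ! (p mod (4 * k)) \<in> set (?blk i)"
      using X[OF i(2)] r(2) by (intro nth_mem) (simp add: length_block)
    ultimately show ?thesis
      by (metis set_block)
  qed
  have C: "symcl E = {((1, p + 1), (1, q + 1)) | p q.
      p < length ?w \<and> q < length ?w \<and> p \<noteq> q \<and> ?w ! p = ?w ! q \<and> ?w ! p \<noteq> 0}" (is "_ = ?C")
  proof (intro equalityI subrelI)
    have "E \<subseteq> ?C"
    proof
      fix e assume "e \<in> E"
      then obtain i r r' where e: "e = ((1, 4 * k * (i + 1) + r + 1), (1, 4 * k * (i + 1) + r' + 1))"
        and i: "i < ?N" and r: "r < r'" "r' < 4 * k" and eq: "?blk i ! r = ?blk i ! r'"
        by (auto simp: E_def)
      have "?blk i ! r \<in> set (?blk i)"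
        using X[OF i] r by (intro nth_mem) (simp add: length_block)
      then have "?blk i ! r \<noteq> 0"
        using X(3)[OF i] by (metis set_block)
      moreover have "4 * k * (i + 1) + r' < length ?w"
      proof -
        have "4 * k * (i + 1) + 4 * k \<le> 4 * k * (?N + 1)"
          using i by (metis Suc_eq_plus1 Suc_leI add_mono1 mult_Suc_right mult_le_mono2 add.commute)
        then show ?thesis
          using r rs by (simp add: length_surface_word algebra_simps)
      qed
      ultimately show "e \<in> ?C"
        unfolding e using r eq surface_word_nth[OF rs i, of r] surface_word_nth[OF rs i, of r']
        by (intro CollectI exI[of _ "4 * k * (i + 1) + r"] exI[of _ "4 * k * (i + 1) + r'"]) simp
    qed
    then show "(x, y) \<in> symcl E \<Longrightarrow> (x, y) \<in> ?C" for x y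
      by (auto simp: symcl_def)
    fix x y assume "(x, y) \<in> ?C"
    then obtain p q where xy: "x = (1, p + 1)" "y = (1, q + 1)"
      and pq: "p < length ?w" "q < length ?w" "p \<noteq> q" "?w ! p = ?w ! q" "?w ! p \<noteq> 0"
      by blast
    obtain i r where i: "p = 4 * k * (i + 1) + r" "i < ?N" "r < 4 * k" "?w ! p \<in> set (snd (rs ! i))"
      using decomp[of p] pq by blast
    obtain j r' where j: "q = 4 * k * (j + 1) + r'" "j < ?N" "r' < 4 * k" "?w ! q \<in> set (snd (rs ! j))"
      using decomp[of q] pq by (metis (no_types))
    \<comment> \<open>Letters of different blocks differ, so equal letters put both places into the
      same block.\<close>
    have "i = j"
      using rs i(2,4) j(2,4) pq(4)
      by (intro distinct_concat_nth_disjoint[of "map snd rs" i j "?w ! p"]) (simp_all add: ribbons_def)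
    then have "?blk i ! r = ?blk i ! r'" "r \<noteq> r'"
      using pq i j surface_word_nth[OF rs i(2,3)] surface_word_nth[OF rs j(2,3)] by auto
    then have "(x, y) \<in> E \<or> (y, x) \<in> E"
      using xy i j \<open>i = j\<close> unfolding E_def by (cases "r < r'") fastforce+
    then show "(x, y) \<in> symcl E"
      by (force simp: symcl_def)
  qed
  show ?thesis
    unfolding typed_grid_def surface_grid_def word_grid_def length_map E C length_surface_word[OF rs]
    by (simp only: cylindrical_grid_def pair_pre_digraph.simps)
qed

section \<open>Exchanging handles and crosscaps\<close>

text \<open>A handle has to keep a part of each of its two strips; the first \<open>2 * k\<close>
  letters of the whole list could all belong to the first strip.\<close>

definition shrink :: "nat \<Rightarrow> bool \<times> nat list \<Rightarrow> bool \<times> nat list" where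
  "shrink k r = (fst r, if fst r then
     take k (take (length (snd r) div 2) (snd r)) @ take k (drop (length (snd r) div 2) (snd r))
   else take (2 * k) (snd r))"

lemma fst_shrink [simp]: "fst (shrink k r) = fst r"
  by (simp add: shrink_def)

lemma length_shrink: "length (snd r) = 2 * K \<Longrightarrow> k \<le> K \<Longrightarrow> length (snd (shrink k r)) = 2 * k"
  by (simp add: shrink_def)

lemma subseq_shrink: "subseq (snd (shrink k r)) (snd r)"
proof (cases "fst r")
  case True
  have "subseq (take k (take n X) @ take k (drop n X)) (take n X @ drop n X)" for n and X :: "nat list"
    by (intro list_emb_append_mono subseq_take)
  then show ?thesis using True by (simp add: shrink_def)
qed (simp add: shrink_def subseq_take)

lemma subseq_block_shrink:
  assumes "length (snd r) = 2 * K" "k \<le> K"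
  shows "subseq (case_prod block (shrink k r)) (case_prod block r)"
proof (cases r)
  case (Pair t X)
  then show ?thesis
    using assms by (cases t)
      (auto simp: shrink_def block_def Let_def intro!: list_emb_append_mono subseq_take subseq_take_take subseq_rev)
qed

lemma subseq_blocks_shrink:
  assumes "\<And>r. r \<in> set rs \<Longrightarrow> length (snd r) = 2 * K" "k \<le> K"
  shows "subseq (blocks (map (shrink k) rs)) (blocks rs)"
  unfolding map_map
  by (rule subseq_concat_map) (simp only: comp_apply assms subseq_block_shrink)

lemma ribbons_exist: "\<exists>rs. ribbons k rs \<and> map fst rs = ts"
proof (induction ts rule: rev_induct)
  case Nil
  then show ?case by (simp add: ribbons_def)
next
  case (snoc t ts)
  then obtain rs where rs: "ribbons k rs" "map fst rs = ts"
    by blast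
  obtain M where M: "\<forall>x\<in>set (0 # concat (map snd rs)). x < M"
    using finite_nat_set_iff_bounded[of "set (0 # concat (map snd rs))"] by blast
  then have "ribbons k (rs @ [(t, [M..<M + 2 * k])])"
    using rs(1) by (fastforce simp: ribbons_def)
  with rs(2) show ?case
    by (intro exI[of _ "rs @ [(t, [M..<M + 2 * k])]"]) simp
qed

text \<open>Reduces an exchange of blocks to a computation with the words of these blocks alone: the
  other blocks are only shrunk. The new letters are taken from the old letters of the exchanged
  blocks, so they cannot clash with the surroundings.\<close>

lemma local_reduction:
  assumes k: "0 < k" "k \<le> K"
    and mid: "\<And>U Q ms. U \<noteq> [] \<Longrightarrow> ribbons K ms \<Longrightarrow> map fst ms = tm \<Longrightarrow>
        set (concat (map snd ms)) \<inter> set (U @ Q) = {} \<Longrightarrow>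
        \<exists>ns. ribbons k ns \<and> map fst ns = tn \<and> set (concat (map snd ns)) \<subseteq> set (concat (map snd ms)) \<and>
          is_minor (word_grid k (U @ blocks ns @ Q)) (word_grid K (U @ blocks ms @ Q))"
  shows "is_minor (typed_grid k (ts1 @ tn @ ts2)) (typed_grid K (ts1 @ tm @ ts2))"
proof -
  obtain rs1 ms rs2 where rs: "ribbons K (rs1 @ ms @ rs2)"
    and types: "map fst rs1 = ts1" "map fst ms = tm" "map fst rs2 = ts2"
    using ribbons_exist[of K "ts1 @ tm @ ts2"] by (auto simp: map_eq_append_conv append_eq_map_conv)
  define rs1' rs2' where "rs1' = map (shrink k) rs1" and "rs2' = map (shrink k) rs2"
  \<comment> \<open>\<open>mid\<close> is applied with surroundings already of order
    \<open>k\<close>; only the blocks \<open>ms\<close> still have order \<open>K\<close>.\<close>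
  define U where "U = replicate (4 * k) 0 @ blocks rs1'"
  define Q where "Q = blocks rs2'"
  have sub: "subseq (concat (map snd rs1')) (concat (map snd rs1))"
    "subseq (concat (map snd rs2')) (concat (map snd rs2))"
    unfolding rs1'_def rs2'_def map_map by (intro subseq_concat_map; simp add: subseq_shrink)+
  have len: "length (snd r) = 2 * K" if "r \<in> set (rs1 @ ms @ rs2)" for r
    using rs that by (simp add: ribbons_def)
  have subblk: "subseq (blocks rs1') (blocks rs1)" "subseq Q (blocks rs2)"
    unfolding Q_def rs1'_def rs2'_def using len k by (intro subseq_blocks_shrink; simp)+
  have sets: "set (blocks rs) = set (concat (map snd rs))" for rs
    by (induction rs) auto
  have "ribbons K ms"
    using rs by (auto simp: ribbons_def)
  moreover have "set (concat (map snd ms)) \<inter> set (U @ Q) = {}"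
  proof -
    have "set (U @ Q) \<subseteq> {0} \<union> set (concat (map snd rs1)) \<union> set (concat (map snd rs2))"
      using subseq_set[OF sub(1)] subseq_set[OF sub(2)] unfolding U_def Q_def
      by (auto simp: sets simp del: set_concat)
    then show ?thesis
      using rs by (fastforce simp: ribbons_def simp del: set_concat)
  qed
  moreover have "U \<noteq> []"
    using k by (simp add: U_def)
  ultimately obtain ns where ns: "ribbons k ns" "map fst ns = tn"
    "set (concat (map snd ns)) \<subseteq> set (concat (map snd ms))"
    "is_minor (word_grid k (U @ blocks ns @ Q)) (word_grid K (U @ blocks ms @ Q))"
    using mid[OF _ _ types(2), of U Q] by auto
  have "ribbons k (rs1' @ ns @ rs2')"
  proof -
    have "length (snd r) = 2 * k" if "r \<in> set (rs1' @ ns @ rs2')" for r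
      using that ns(1) len k by (auto simp: ribbons_def rs1'_def rs2'_def intro: length_shrink)
    moreover have "distinct (0 # concat (map snd (rs1' @ ns @ rs2')))"
      using rs ns(1,3) subseq_set[OF sub(1)] subseq_set[OF sub(2)]
        subseq_distinct[OF sub(1)] subseq_distinct[OF sub(2)]
      unfolding ribbons_def by (simp del: set_concat) blast
    ultimately show ?thesis
      by (simp add: ribbons_def)
  qed
  moreover have "map fst (rs1' @ ns @ rs2') = ts1 @ tn @ ts2"
    using types ns(2) by (simp add: rs1'_def rs2'_def comp_def)
  ultimately have "typed_grid k (ts1 @ tn @ ts2) = word_grid k (U @ blocks ns @ Q)"
    using typed_grid_eq_word_grid[of k "rs1' @ ns @ rs2'"] by (simp add: surface_word_def U_def Q_def)
  moreover have "typed_grid K (ts1 @ tm @ ts2) = word_grid K (surface_word K (rs1 @ ms @ rs2))"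
    using typed_grid_eq_word_grid[OF rs] types by simp
  moreover have "is_minor (word_grid K (U @ blocks ms @ Q)) (word_grid K (surface_word K (rs1 @ ms @ rs2)))"
  proof -
    \<comment> \<open>One zero is set aside as the nonempty prefix for deletions, \<open>k'\<close>
      more are kept, and the \<open>l\<close> further ones of order \<open>K\<close> are
      deleted.\<close>
    obtain k' where k': "4 * k = Suc k'"
      using k by (cases "4 * k") auto
    obtain l where l: "4 * K = Suc k' + l"
      using k k' le_iff_add[of "4 * k" "4 * K"] by auto
    have "subseq (replicate k' 0 @ blocks rs1' @ blocks ms @ Q) ((replicate k' 0 @ replicate l 0) @ blocks rs1 @ blocks ms @ blocks rs2)"
      using subblk by (intro list_emb_append_mono subseq_rev_drop_many subseq_order.order_refl)
    then have "is_minor (word_grid K ([0] @ replicate k' 0 @ blocks rs1' @ blocks ms @ Q))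
        (word_grid K ([0] @ (replicate k' 0 @ replicate l 0) @ blocks rs1 @ blocks ms @ blocks rs2))"
      using k by (intro word_grid_subseq_minor) auto
    then show ?thesis
      by (simp add: U_def surface_word_def k' l replicate_add)
  qed
  ultimately show ?thesis
    using ns(4) is_minor_trans by metis
qed

text \<open>\<open>local_reduction\<close> with nothing exchanged, so that only the shrinking of the
  other blocks remains.\<close>

lemma typed_grid_shrink_minor:
  assumes "0 < k" "k \<le> K"
  shows "is_minor (typed_grid k ts) (typed_grid K ts)"
  using local_reduction[of k K "[]" "[]" ts "[]"] assms
  by (auto simp: ribbons_def intro: word_grid_depth_minor)

section \<open>The three exchanges: commutation, handle to crosscaps, crosscaps to handle\<close>

text \<open>\<open>Y\<close> passes both copies of the strip. The first slide consumes
  \<open>x3\<close> and leaves \<open>rev Y\<close> between the copies, the second consumes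
  \<open>x2\<close> and restores the orientation, so \<open>Y\<close> may be the word of a
  handle.\<close>

lemma crosscap_commute_right:
  assumes d: "0 < d" and U: "U \<noteq> []"
    and dist: "distinct (0 # x1 @ x2 @ x3)" and Y: "0 \<notin> set Y" "length x2 = length Y" "length x3 = length Y"
    and disj: "set (x1 @ x2 @ x3) \<inter> set (U @ Y @ Q) = {}"
  shows "is_minor (word_grid d (U @ Y @ x1 @ x1 @ Q))
    (word_grid (d + 2 * length Y) (U @ (x2 @ x1 @ x3) @ (x2 @ x1 @ x3) @ Y @ Q))"
proof -
  have "is_minor (word_grid (d + length Y) ((U @ x2 @ x1) @ rev Y @ (x2 @ x1) @ Q))
      (word_grid (d + length Y + length Y) ((U @ x2 @ x1) @ x3 @ (x2 @ x1) @ x3 @ Y @ Q))"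
    using assms by (intro slide_right_after) auto
  moreover have "is_minor (word_grid d (U @ rev (rev Y) @ x1 @ x1 @ Q))
      (word_grid (d + length (rev Y)) (U @ x2 @ x1 @ rev Y @ x2 @ x1 @ Q))"
    using assms by (intro slide_right_before) auto
  ultimately show ?thesis
    by (auto intro: is_minor_trans simp: mult_2 add.assoc)
qed

lemma crosscap_commute_left:
  assumes d: "0 < d" and U: "U \<noteq> []"
    and dist: "distinct (0 # x1 @ x2 @ x3)" and Y: "0 \<notin> set Y" "length x2 = length Y" "length x3 = length Y"
    and disj: "set (x1 @ x2 @ x3) \<inter> set (U @ Y @ Q) = {}"
  shows "is_minor (word_grid d (U @ x1 @ x1 @ Y @ Q))
    (word_grid (d + 2 * length Y) (U @ Y @ (x3 @ x1 @ x2) @ (x3 @ x1 @ x2) @ Q))"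
proof -
  have "is_minor (word_grid (d + length Y) (U @ (x1 @ x2) @ rev Y @ (x1 @ x2) @ Q))
      (word_grid (d + length Y + length Y) (U @ Y @ x3 @ (x1 @ x2) @ x3 @ (x1 @ x2) @ Q))"
    using assms by (intro slide_left_after) auto
  moreover have "is_minor (word_grid d ((U @ x1) @ x1 @ rev (rev Y) @ Q))
      (word_grid (d + length (rev Y)) ((U @ x1) @ x2 @ rev Y @ x1 @ x2 @ Q))"
    using assms by (intro slide_left_before) auto
  ultimately show ?thesis
    by (auto intro: is_minor_trans simp: mult_2 add.assoc)
qed

text \<open>
  \<open>a b a\<^sup>- b\<^sup>- c c \<longrightarrow> a b c b a c \<longrightarrow> a a b\<^sup>- c\<^sup>- b\<^sup>- c \<longrightarrow> a a b\<^sup>- b\<^sup>- c c\<close>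
\<close>

lemma handle_to_crosscaps:
  assumes d: "0 < d" and U: "U \<noteq> []"
    and dist: "distinct (0 # a1 @ a2 @ b1 @ b2 @ c1 @ c2)"
    and len: "length c2 = length (a1 @ a2 @ b1 @ b2)" "length a2 = 2 * length (b1 @ b2) + length c1"
      "length b2 = length c1"
    and disj: "set (a1 @ a2 @ b1 @ b2 @ c1 @ c2) \<inter> set (U @ Q) = {}"
  shows "is_minor (word_grid d (U @ a1 @ a1 @ rev b1 @ rev b1 @ c1 @ c1 @ Q))
    (word_grid (d + (length c2 + length a2 + length b2))
      (U @ (a1 @ a2) @ (b2 @ b1) @ rev (a1 @ a2) @ rev (b2 @ b1) @ (c2 @ c1) @ (c2 @ c1) @ Q))"
proof -
  let ?a = "a1 @ a2" and ?b = "b2 @ b1"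
  \<comment> \<open>Slide 1 consumes \<open>c2\<close>, slide 2 \<open>a2\<close>, slide 3
    \<open>b2\<close>. The equations in \<open>len\<close> say that each of these is as long as the
    word moved along it, and the depths add up accordingly.\<close>
  have 1: "is_minor (word_grid (d + length b2 + length a2) ((U @ ?a @ ?b) @ c1 @ rev (rev ?a @ rev ?b) @ (c1 @ Q)))
      (word_grid (d + length b2 + length a2 + length (rev ?a @ rev ?b))
        ((U @ ?a @ ?b) @ (rev ?a @ rev ?b) @ c2 @ c1 @ c2 @ (c1 @ Q)))"
    using assms by (intro slide_left_after) auto
  have 2: "is_minor (word_grid (d + length b2) ((U @ a1) @ a1 @ rev (?b @ c1 @ ?b) @ (c1 @ Q)))
      (word_grid (d + length b2 + length (?b @ c1 @ ?b)) ((U @ a1) @ a2 @ (?b @ c1 @ ?b) @ a1 @ a2 @ (c1 @ Q)))"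
    using assms by (intro slide_left_before) auto
  have 3: "is_minor (word_grid d ((U @ a1 @ a1 @ rev b1) @ rev b1 @ rev (rev c1) @ (c1 @ Q)))
      (word_grid (d + length (rev c1)) ((U @ a1 @ a1 @ rev b1) @ rev b2 @ rev c1 @ rev b1 @ rev b2 @ (c1 @ Q)))"
    using assms by (intro slide_left_before) auto
  have e: "length (rev c1) = length b2" "length (?b @ c1 @ ?b) = length a2" "length (rev ?a @ rev ?b) = length c2"
    using len by auto
  show ?thesis
    using is_minor_trans[OF 3[unfolded e, simplified] is_minor_trans[OF 2[unfolded e, simplified] 1[unfolded e, simplified], simplified], simplified]
    by (simp add: ac_simps)
qed

text \<open>
  \<open>a a b b c c \<longrightarrow> a a b c\<^sup>- b c \<longrightarrow> a b\<^sup>- c b\<^sup>- a c \<longrightarrow> a b\<^sup>- a\<^sup>- b c c\<close>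
\<close>

lemma crosscaps_to_handle:
  assumes d: "0 < d" and U: "U \<noteq> []"
    and dist: "distinct (0 # a1 @ a2 @ b1 @ b2 @ c1 @ c2)"
    and len: "length b2 = length (c1 @ c2)" "length a2 = 2 * length b1 + length (c1 @ c2)"
      "length c2 = length (a1 @ b1)"
    and disj: "set (a1 @ a2 @ b1 @ b2 @ c1 @ c2) \<inter> set (U @ Q) = {}"
  shows "is_minor (word_grid d (U @ a1 @ rev b1 @ rev a1 @ b1 @ c1 @ c1 @ Q))
    (word_grid (d + (length c2 + length a2 + length b2))
      (U @ (a1 @ a2) @ (a1 @ a2) @ (b1 @ b2) @ (b1 @ b2) @ (c2 @ c1) @ (c2 @ c1) @ Q))"
proof -
  let ?c = "c2 @ c1"
  \<comment> \<open>Here the slides consume \<open>b2\<close>, \<open>a2\<close>, \<open>c2\<close>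
    in this order; again \<open>len\<close> equates each with the length of the word it
    moves.\<close>
  have 1: "is_minor (word_grid (d + length c2 + length a2) ((U @ (a1 @ a2) @ (a1 @ a2) @ b1) @ rev ?c @ b1 @ (?c @ Q)))
      (word_grid (d + length c2 + length a2 + length ?c)
        ((U @ (a1 @ a2) @ (a1 @ a2) @ b1) @ b2 @ b1 @ b2 @ ?c @ (?c @ Q)))"
    using assms by (intro slide_right_after) auto
  have 2: "is_minor (word_grid (d + length c2) ((U @ a1) @ rev (b1 @ rev ?c @ b1) @ a1 @ (?c @ Q)))
      (word_grid (d + length c2 + length (b1 @ rev ?c @ b1)) ((U @ a1) @ a2 @ a1 @ a2 @ (b1 @ rev ?c @ b1) @ (?c @ Q)))"
    using assms by (intro slide_right_after) auto
  have 3: "is_minor (word_grid d ((U @ a1 @ rev b1) @ rev (rev b1 @ a1) @ c1 @ (c1 @ Q)))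
      (word_grid (d + length (rev b1 @ a1)) ((U @ a1 @ rev b1) @ c2 @ c1 @ (rev b1 @ a1) @ c2 @ (c1 @ Q)))"
    using assms by (intro slide_right_before) auto
  have e: "length ?c = length b2" "length (b1 @ rev ?c @ b1) = length a2" "length (rev b1 @ a1) = length c2"
    using len by auto
  show ?thesis
    using is_minor_trans[OF 3[unfolded e, simplified] is_minor_trans[OF 2[unfolded e, simplified] 1[unfolded e, simplified], simplified], simplified]
    by (simp add: ac_simps)
qed

lemma word_grid_subword_minor:
  assumes "is_minor H (word_grid d (U @ w' @ Q))" "subseq w' w" "0 < d" "d \<le> K" "U \<noteq> []"
  shows "is_minor H (word_grid K (U @ w @ Q))"
proof -
  have "is_minor (word_grid d (U @ w' @ Q)) (word_grid K (U @ w' @ Q))"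
    using assms by (intro word_grid_depth_minor)
  moreover have "is_minor (word_grid K (U @ w' @ Q)) (word_grid K (U @ w @ Q))"
    using assms by (intro word_grid_subseq_minor list_emb_append_mono) auto
  ultimately show ?thesis
    using assms(1) is_minor_trans by blast
qed

text \<open>The three resulting strips need \<open>2 * k\<close> letters each. The length equations
  of \<open>handle_to_crosscaps\<close> then give \<open>2 * k\<close> for \<open>b2\<close>,
  \<open>10 * k\<close> for \<open>a2\<close> and \<open>16 * k\<close> for \<open>c2\<close>, hence
  depth \<open>k + 28 * k\<close>. The strips of order \<open>29 * k\<close> are long enough for
  these pieces.\<close>

lemma handle_crosscap_to_crosscaps:
  assumes "0 < k" "29 * k \<le> K"
  shows "is_minor (typed_grid k (ts1 @ [False, False, False] @ ts2)) (typed_grid K (ts1 @ [True, False] @ ts2))"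
proof (rule local_reduction)
  fix U Q :: "nat list" and ms
  assume U: "U \<noteq> []" and ms: "ribbons K ms" "map fst ms = [True, False]"
    and disj: "set (concat (map snd ms)) \<inter> set (U @ Q) = {}"
  obtain X Z where ms_eq: "ms = [(True, X), (False, Z)]"
    using ms(2) by (auto simp: map_eq_Cons_conv)
  then have len: "length X = 2 * K" "length Z = 2 * K"
    using ms(1) by (auto simp: ribbons_def)
  define A B where "A = take K X" and "B = drop K X"
  have X: "X = A @ B"
    by (simp add: A_def B_def)
  obtain a1 a2 a3 where A: "A = a1 @ a2 @ a3" "length a1 = 2 * k" "length a2 = 10 * k"
    using split_length_le[of "2 * k" "10 * k" A] len assms unfolding A_def by auto
  obtain b1 b2 b3 where B: "B = b2 @ b1 @ b3" "length b2 = 2 * k" "length b1 = 2 * k"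
    using split_length_le[of "2 * k" "2 * k" B] len assms unfolding B_def by auto
  obtain c1 c2 c3 where Z: "Z = c2 @ c1 @ c3" "length c2 = 16 * k" "length c1 = 2 * k"
    using split_length_le[of "16 * k" "2 * k" Z] len assms by (auto)
  \<comment> \<open>The middle crosscap carries \<open>rev b1\<close> because slide 2 reverses the
    \<open>b\<close> strip.\<close>
  let ?ns = "[(False, a1), (False, rev b1), (False, c1)]"
  have "is_minor (word_grid k (U @ a1 @ a1 @ rev b1 @ rev b1 @ c1 @ c1 @ Q))
      (word_grid (k + (length c2 + length a2 + length b2))
        (U @ (a1 @ a2) @ (b2 @ b1) @ rev (a1 @ a2) @ rev (b2 @ b1) @ (c2 @ c1) @ (c2 @ c1) @ Q))"
    using assms ms(1) disj U A B Z
    by (intro handle_to_crosscaps) (auto simp: ms_eq X ribbons_def)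
  then have "is_minor (word_grid k (U @ blocks ?ns @ Q)) (word_grid (29 * k)
      (U @ ((a1 @ a2) @ (b2 @ b1) @ rev (a1 @ a2) @ rev (b2 @ b1) @ (c2 @ c1) @ (c2 @ c1)) @ Q))"
    using A B Z by (simp add: block_def)
  moreover have "subseq ((a1 @ a2) @ (b2 @ b1) @ rev (a1 @ a2) @ rev (b2 @ b1) @ (c2 @ c1) @ (c2 @ c1)) (blocks ms)"
  proof -
    have "blocks ms = A @ B @ rev A @ rev B @ Z @ Z"
      using len by (simp add: ms_eq block_def Let_def A_def B_def)
    moreover have "subseq (a1 @ a2) A" "subseq (b2 @ b1) B" "subseq (c2 @ c1) Z"
      using A B Z subseq_append_left by (metis append_assoc)+
    ultimately show ?thesis
      by (simp only:) (intro list_emb_append_mono subseq_rev; assumption)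
  qed
  ultimately have "is_minor (word_grid k (U @ blocks ?ns @ Q)) (word_grid K (U @ blocks ms @ Q))"
    using assms U by (elim word_grid_subword_minor) auto
  moreover have "ribbons k ?ns" "set (concat (map snd ?ns)) \<subseteq> set (concat (map snd ms))"
    using ms(1) A B Z by (auto simp: ms_eq X ribbons_def)
  ultimately show "\<exists>ns. ribbons k ns \<and> map fst ns = [False, False, False] \<and>
      set (concat (map snd ns)) \<subseteq> set (concat (map snd ms)) \<and>
      is_minor (word_grid k (U @ blocks ns @ Q)) (word_grid K (U @ blocks ms @ Q))"
    by (intro exI[of _ ?ns] conjI) auto
qed (use assms in auto)

text \<open>The handle needs two strips of \<open>k\<close> letters and the crosscap one of
  \<open>2 * k\<close>. The length equations of \<open>crosscaps_to_handle\<close> give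
  \<open>2 * k\<close> for \<open>c2\<close>, \<open>4 * k\<close> for \<open>b2\<close> and
  \<open>6 * k\<close> for \<open>a2\<close>, hence depth \<open>k + 12 * k\<close>.\<close>

lemma crosscaps_to_handle_crosscap:
  assumes "0 < k" "13 * k \<le> K"
  shows "is_minor (typed_grid k (ts1 @ [True, False] @ ts2)) (typed_grid K (ts1 @ [False, False, False] @ ts2))"
proof (rule local_reduction)
  fix U Q :: "nat list" and ms
  assume U: "U \<noteq> []" and ms: "ribbons K ms" "map fst ms = [False, False, False]"
    and disj: "set (concat (map snd ms)) \<inter> set (U @ Q) = {}"
  obtain X Y Z where ms_eq: "ms = [(False, X), (False, Y), (False, Z)]"
    using ms(2) by (auto simp: map_eq_Cons_conv)
  then have len: "length X = 2 * K" "length Y = 2 * K" "length Z = 2 * K"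
    using ms(1) by (auto simp: ribbons_def)
  obtain a1 a2 a3 where X: "X = a1 @ a2 @ a3" "length a1 = k" "length a2 = 6 * k"
    using split_length_le[of "k" "6 * k" X] len assms by (auto)
  obtain b1 b2 b3 where Y: "Y = b1 @ b2 @ b3" "length b1 = k" "length b2 = 4 * k"
    using split_length_le[of "k" "4 * k" Y] len assms by (auto)
  obtain c1 c2 c3 where Z: "Z = c2 @ c1 @ c3" "length c2 = 2 * k" "length c1 = 2 * k"
    using split_length_le[of "2 * k" "2 * k" Z] len assms by (auto)
  \<comment> \<open>With strips \<open>a1\<close> and \<open>rev b1\<close>, the handle word is
    \<open>a1 @ rev b1 @ rev a1 @ b1\<close>, as produced by the slides.\<close>
  let ?ns = "[(True, a1 @ rev b1), (False, c1)]"
  have "is_minor (word_grid k (U @ a1 @ rev b1 @ rev a1 @ b1 @ c1 @ c1 @ Q))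
      (word_grid (k + (length c2 + length a2 + length b2))
        (U @ (a1 @ a2) @ (a1 @ a2) @ (b1 @ b2) @ (b1 @ b2) @ (c2 @ c1) @ (c2 @ c1) @ Q))"
    using assms ms(1) disj U X Y Z
    by (intro crosscaps_to_handle) (auto simp: ms_eq ribbons_def)
  then have "is_minor (word_grid k (U @ blocks ?ns @ Q)) (word_grid (13 * k)
      (U @ ((a1 @ a2) @ (a1 @ a2) @ (b1 @ b2) @ (b1 @ b2) @ (c2 @ c1) @ (c2 @ c1)) @ Q))"
    using X Y Z by (simp add: block_def Let_def)
  moreover have "subseq ((a1 @ a2) @ (a1 @ a2) @ (b1 @ b2) @ (b1 @ b2) @ (c2 @ c1) @ (c2 @ c1)) (blocks ms)"
  proof -
    have "blocks ms = X @ X @ Y @ Y @ Z @ Z"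
      by (simp add: ms_eq block_def)
    moreover have "subseq (a1 @ a2) X" "subseq (b1 @ b2) Y" "subseq (c2 @ c1) Z"
      using X Y Z subseq_append_left by (metis append_assoc)+
    ultimately show ?thesis
      by (simp only:) (intro list_emb_append_mono; assumption)
  qed
  ultimately have "is_minor (word_grid k (U @ blocks ?ns @ Q)) (word_grid K (U @ blocks ms @ Q))"
    using assms U by (elim word_grid_subword_minor) auto
  moreover have "ribbons k ?ns" "set (concat (map snd ?ns)) \<subseteq> set (concat (map snd ms))"
    using ms(1) X Y Z by (auto simp: ms_eq ribbons_def)
  ultimately show "\<exists>ns. ribbons k ns \<and> map fst ns = [True, False] \<and>
      set (concat (map snd ns)) \<subseteq> set (concat (map snd ms)) \<and>
      is_minor (word_grid k (U @ blocks ns @ Q)) (word_grid K (U @ blocks ms @ Q))"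
    by (intro exI[of _ ?ns] conjI) auto
qed (use assms in auto)

text \<open>The handle is first shrunk to order \<open>k\<close>, so its word has
  \<open>4 * k\<close> letters. Passing it twice along the crosscap strip takes \<open>8 * k\<close>
  cycles besides the \<open>k\<close> that remain, and \<open>4 * k + 2 * k + 4 * k\<close> letters
  of the strip. The test \<open>hd tm\<close> tells the two directions apart.\<close>

lemma crosscap_past_handle:
  assumes "0 < k" "10 * k \<le> K" and tm: "{(tm, tn)} \<subseteq> {([False, True], [True, False]), ([True, False], [False, True])}"
  shows "is_minor (typed_grid k (ts1 @ tn @ ts2)) (typed_grid K (ts1 @ tm @ ts2))"
proof (rule local_reduction)
  fix U Q :: "nat list" and ms
  assume U: "U \<noteq> []" and ms: "ribbons K ms" "map fst ms = tm"
    and disj: "set (concat (map snd ms)) \<inter> set (U @ Q) = {}"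
  obtain X Z where ms_eq: "ms = (if hd tm then [(True, Z), (False, X)] else [(False, X), (True, Z)])"
    using ms(2) tm by (auto simp: map_eq_Cons_conv)
  then have len: "length X = 2 * K" "length Z = 2 * K"
    using ms(1) by (auto simp: ribbons_def split: if_splits)
  obtain x1 x2 x3 x4 where X: "X = x2 @ x1 @ x3 @ x4" "length x2 = 4 * k" "length x1 = 2 * k" "length x3 = 4 * k"
    using split_length_le3[of "4 * k" "2 * k" "4 * k" X] len assms by (auto)
  define Z' where "Z' = snd (shrink k (True, Z))"
  have Z': "length Z' = 2 * k" "subseq Z' Z" "subseq (block True Z') (block True Z)"
    using length_shrink[of "(True, Z)" K k] subseq_shrink[of k "(True, Z)"]
      subseq_block_shrink[of "(True, Z)" K k] len assms
    by (auto simp: Z'_def shrink_def)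
  let ?Y = "block True Z'" and ?x = "x2 @ x1 @ x3"
  let ?ns = "if hd tm then [(False, x1), (True, Z')] else [(True, Z'), (False, x1)]"
  have Y: "length ?Y = 4 * k" "set ?Y \<subseteq> set Z"
    using Z' by (auto simp: length_block dest: subseq_set)
  let ?w = "if hd tm then ?Y @ ?x @ ?x else ?x @ ?x @ ?Y"
  have "is_minor (word_grid k (U @ blocks ?ns @ Q)) (word_grid (9 * k) (U @ ?w @ Q))"
  proof (cases "hd tm")
    case True
    have "is_minor (word_grid k (U @ x1 @ x1 @ ?Y @ Q)) (word_grid (k + 2 * length ?Y) (U @ ?Y @ ?x @ ?x @ Q))"
      using assms ms(1) disj U X Y True
      by (intro crosscap_commute_left) (auto simp: ms_eq ribbons_def simp del: set_block)
    then show ?thesis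
      using True Y(1) by (simp add: block_def[of False])
  next
    case False
    have "is_minor (word_grid k (U @ ?Y @ x1 @ x1 @ Q)) (word_grid (k + 2 * length ?Y) (U @ ?x @ ?x @ ?Y @ Q))"
      using assms ms(1) disj U X Y False
      by (intro crosscap_commute_right) (auto simp: ms_eq ribbons_def simp del: set_block)
    then show ?thesis
      using False Y(1) by (simp add: block_def[of False])
  qed
  moreover have "subseq ?w (blocks ms)"
  proof -
    have "subseq ?x X"
      unfolding X using subseq_append_left[of ?x x4] by simp
    then have "subseq (?x @ ?x) (X @ X)"
      by (intro list_emb_append_mono)
    then have "subseq (?Y @ ?x @ ?x) (block True Z @ X @ X)" "subseq ((?x @ ?x) @ ?Y) ((X @ X) @ block True Z)"
      using Z'(3) list_emb_append_mono by blast+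
    moreover have "blocks ms = (if hd tm then block True Z @ X @ X else X @ X @ block True Z)"
      by (simp add: ms_eq block_def[of False])
    ultimately show ?thesis
      by (simp split: if_splits)
  qed
  ultimately have "is_minor (word_grid k (U @ blocks ?ns @ Q)) (word_grid K (U @ blocks ms @ Q))"
    using assms U by (elim word_grid_subword_minor) auto
  moreover have "ribbons k ?ns" "set (concat (map snd ?ns)) \<subseteq> set (concat (map snd ms))"
    using ms(1) X Z' subseq_set[OF Z'(2)] subseq_distinct[OF Z'(2)]
    by (auto simp: ms_eq ribbons_def split: if_splits)
  moreover have "map fst ?ns = tn"
    using tm by auto
  ultimately show "\<exists>ns. ribbons k ns \<and> map fst ns = tn \<and>
      set (concat (map snd ns)) \<subseteq> set (concat (map snd ms)) \<and>
      is_minor (word_grid k (U @ blocks ns @ Q)) (word_grid K (U @ blocks ms @ Q))"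
    by blast
qed (use assms in auto)

section \<open>Normal form with crosscaps only\<close>

lemma adjacent_distinct_bools:
  assumes "True \<in> set ts" "False \<in> set ts"
  obtains ts1 ts2 where "ts = ts1 @ [True, False] @ ts2" | ts1 ts2 where "ts = ts1 @ [False, True] @ ts2"
proof -
  have "\<exists>ts1 ts2 t. ts = ts1 @ [t, \<not> t] @ ts2"
    using assms
  proof (induction ts)
    case (Cons t ts)
    show ?case
    proof (cases "hd ts = t \<or> ts = []")
      case True
      then have "True \<in> set ts \<and> False \<in> set ts"
        using Cons.prems by (cases ts; cases t) auto
      then show ?thesis
        using Cons.IH by (metis append_Cons)
    next
      case False
      then have "t # ts = [] @ [t, \<not> t] @ tl ts"
        by (cases ts) auto
      then show ?thesis by blast
    qed
  qed simp
  then show thesis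
    using that by (metis (full_types))
qed

abbreviation handles :: "bool list \<Rightarrow> nat" where
  "handles ts \<equiv> length (filter (\<lambda>t. t) ts)"

abbreviation crosscaps :: "bool list \<Rightarrow> nat" where
  "crosscaps ts \<equiv> length (filter Not ts)"

text \<open>The exchanges want the handle directly in front of a crosscap. If only the opposite
  order is at hand, a commutation by the factor 10 comes in addition; \<open>290 = 29 * 10\<close>
  covers this in the more expensive direction.\<close>

lemma exchange_handle:
  assumes "True \<in> set ts" "False \<in> set ts"
  obtains ts' where "False \<in> set ts'" "handles ts = Suc (handles ts')" "crosscaps ts' = crosscaps ts + 2"
    "\<And>k. 0 < k \<Longrightarrow> is_minor (typed_grid k ts') (typed_grid (290 * k) ts)"
    "\<And>k. 0 < k \<Longrightarrow> is_minor (typed_grid k ts) (typed_grid (290 * k) ts')"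
  using assms
proof (cases rule: adjacent_distinct_bools)
  case (1 ts1 ts2)
  then show thesis
    by (intro that[of "ts1 @ [False, False, False] @ ts2"])
      (simp_all only: handle_crosscap_to_crosscaps crosscaps_to_handle_crosscap, auto)
next
  case (2 ts1 ts2)
  let ?ts' = "ts1 @ [False, False, False] @ ts2"
  have "is_minor (typed_grid k ?ts') (typed_grid (290 * k) ts)" if "0 < k" for k
  proof (rule is_minor_trans)
    show "is_minor (typed_grid k ?ts') (typed_grid (29 * k) (ts1 @ [True, False] @ ts2))"
      using that by (intro handle_crosscap_to_crosscaps) auto
    show "is_minor (typed_grid (29 * k) (ts1 @ [True, False] @ ts2)) (typed_grid (290 * k) ts)"
      unfolding 2 using that by (intro crosscap_past_handle) auto
  qed
  moreover have "is_minor (typed_grid k ts) (typed_grid (290 * k) ?ts')" if "0 < k" for k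
  proof (rule is_minor_trans)
    show "is_minor (typed_grid (10 * k) (ts1 @ [True, False] @ ts2)) (typed_grid (290 * k) ?ts')"
      using that by (intro crosscaps_to_handle_crosscap) auto
    show "is_minor (typed_grid k ts) (typed_grid (10 * k) (ts1 @ [True, False] @ ts2))"
      unfolding 2 using that by (intro crosscap_past_handle) auto
  qed
  ultimately show thesis
    using 2 by (intro that[of ?ts']) auto
qed

lemma crosscap_normal_form:
  assumes "False \<in> set ts" "0 < k"
  shows "is_minor (typed_grid k (replicate (2 * handles ts + crosscaps ts) False)) (typed_grid (290 ^ handles ts * k) ts) \<and>
    is_minor (typed_grid k ts) (typed_grid (290 ^ handles ts * k) (replicate (2 * handles ts + crosscaps ts) False))"
  using assms
proof (induction "handles ts" arbitrary: ts k)
  case 0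
  then have "\<forall>t\<in>set ts. t = False"
    by (auto simp: filter_empty_conv)
  then have ts: "ts = replicate (length ts) False"
    by (metis replicate_eqI)
  then have "crosscaps ts = length ts"
    by (metis filter_True length_replicate in_set_replicate)
  with 0 have e: "handles ts = 0" "2 * handles ts + crosscaps ts = length ts"
    by simp_all
  show ?case
    using typed_grid_shrink_minor[OF \<open>0 < k\<close> order_refl, of ts]
    by (simp only: e(1) e(2)[unfolded e(1)] ts[symmetric] power_0 mult_1 conj_absorb)
next
  case (Suc n)
  have "True \<in> set ts"
    using Suc.hyps(2) by (auto simp: filter_eq_Cons_iff Suc_length_conv)
  then obtain ts' where ts': "False \<in> set ts'" "handles ts = Suc (handles ts')" "crosscaps ts' = crosscaps ts + 2"
    "\<And>k. 0 < k \<Longrightarrow> is_minor (typed_grid k ts') (typed_grid (290 * k) ts)"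
    "\<And>k. 0 < k \<Longrightarrow> is_minor (typed_grid k ts) (typed_grid (290 * k) ts')"
    using exchange_handle Suc.prems(1) by metis
  have g: "2 * handles ts' + crosscaps ts' = 2 * handles ts + crosscaps ts"
    using ts' by simp
  \<comment> \<open>The two directions compose in opposite order: one exchanges the handle at order
    \<open>290 ^ handles ts' * k\<close>, after the induction hypothesis at \<open>k\<close>; the
    other exchanges it at order \<open>k\<close> and uses the induction hypothesis at
    \<open>290 * k\<close>.\<close>
  have n: "n = handles ts'" "290 ^ handles ts * k = 290 * (290 ^ handles ts' * k)"
    "290 ^ handles ts * k = 290 ^ handles ts' * (290 * k)"
    using Suc.hyps(2) ts'(2) by simp_all
  have "is_minor (typed_grid k (replicate (2 * handles ts + crosscaps ts) False)) (typed_grid (290 ^ handles ts * k) ts)"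
    using is_minor_trans[OF conjunct1[OF Suc.hyps(1)[OF n(1) ts'(1) Suc.prems(2)]] ts'(4)[of "290 ^ handles ts' * k"]] Suc.prems(2)
    unfolding g n(2) by simp
  moreover have "is_minor (typed_grid k ts) (typed_grid (290 ^ handles ts * k) (replicate (2 * handles ts + crosscaps ts) False))"
    using is_minor_trans[OF ts'(5)[OF Suc.prems(2)] conjunct2[OF Suc.hyps(1)[OF n(1) ts'(1), of "290 * k"]]] Suc.prems(2)
    unfolding g n(3) by simp
  ultimately show ?case ..
qed

section \<open>Comparison of mixed surface grids and the final bound\<close>

lemma mixed_surface_grid_typed:
  assumes "mixed_surface_grid k h c G"
  obtains ts where "G = typed_grid k ts" "handles ts = h" "crosscaps ts = c"
proof -
  obtain Ih Ic where I: "Ih \<union> Ic = {2..h+c+1}" "Ih \<inter> Ic = {}" "card Ih = h" "card Ic = c"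
    and G: "G = surface_grid k (h+c+1) Ih Ic"
    using assms by (auto simp: mixed_surface_grid_def)
  define ts where "ts = map (\<lambda>i. i + 2 \<in> Ih) [0..<h + c]"
  have Ih: "Ih = (\<lambda>i. i + 2) ` {i. i < h + c \<and> ts ! i}" (is "_ = _ ` ?H")
  proof (intro equalityI subsetI)
    fix x assume "x \<in> Ih"
    then have "x \<in> {2..h+c+1}" using I(1) by blast
    then have "x = x - 2 + 2" "x - 2 < h + c" by auto
    with \<open>x \<in> Ih\<close> show "x \<in> (\<lambda>i. i + 2) ` ?H"
      by (intro image_eqI[of _ _ "x - 2"] CollectI conjI) (simp_all only: ts_def nth_map nth_upt length_upt add_0 diff_zero)
  qed (auto simp: ts_def)
  have Ic: "Ic = (\<lambda>i. i + 2) ` {i. i < h + c \<and> \<not> ts ! i}" (is "_ = _ ` ?C")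
  proof (intro equalityI subsetI)
    fix x assume "x \<in> Ic"
    then have "x \<in> {2..h+c+1}" "x \<notin> Ih" using I(1,2) by blast+
    moreover from this have "x = x - 2 + 2" "x - 2 < h + c" by auto
    ultimately show "x \<in> (\<lambda>i. i + 2) ` ?C"
      by (intro image_eqI[of _ _ "x - 2"] CollectI conjI) (simp_all only: ts_def nth_map nth_upt length_upt add_0 diff_zero not_False_eq_True)
  next
    fix x assume "x \<in> (\<lambda>i. i + 2) ` ?C"
    then have "x \<notin> Ih" "x \<in> {2..h+c+1}" by (auto simp: ts_def)
    then show "x \<in> Ic" using I(1) by blast
  qed
  have "card Ih = card ?H" "card Ic = card ?C"
    unfolding Ih Ic by (intro card_image; simp add: inj_on_def)+
  then have "handles ts = h" "crosscaps ts = c"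
    using I by (simp_all add: length_filter_conv_card ts_def)
  moreover have "G = typed_grid k ts"
    unfolding G typed_grid_def by (subst Ih, subst Ic) (auto simp: ts_def intro!: arg_cong2[where f = "surface_grid k (Suc (h + c))"])
  ultimately show thesis
    by (intro that)
qed

text \<open>\<open>H\<close> embeds into the grid with crosscaps only at a factor 290 for each of
  its \<open>h'\<close> handles, and that grid embeds into \<open>G\<close> at a factor 290 for each
  of the \<open>h\<close> handles of \<open>G\<close>; hence the exponent
  \<open>h + h'\<close>.\<close>

lemma mixed_surface_grid_minor:
  assumes G: "mixed_surface_grid K h c G" and H: "mixed_surface_grid k h' c' H"
    and c: "0 < c" "0 < c'" and g: "2 * h + c = 2 * h' + c'"
    and k: "0 < k" "290 ^ (h + h') * k \<le> K"
  shows "is_minor H G"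
proof -
  obtain ts where ts: "G = typed_grid K ts" "handles ts = h" "crosscaps ts = c"
    using G by (rule mixed_surface_grid_typed)
  obtain us where us: "H = typed_grid k us" "handles us = h'" "crosscaps us = c'"
    using H by (rule mixed_surface_grid_typed)
  have F: "False \<in> set ts" "False \<in> set us"
    using c ts us by (auto simp: filter_empty_conv simp flip: length_greater_0_conv)
  have "is_minor H (typed_grid (290 ^ h' * k) (replicate (2 * h + c) False))"
    using crosscap_normal_form[OF F(2) k(1)] us g by simp
  moreover have "is_minor (typed_grid (290 ^ h' * k) (replicate (2 * h + c) False)) (typed_grid (290 ^ h * (290 ^ h' * k)) ts)"
    using crosscap_normal_form[OF F(1), of "290 ^ h' * k"] ts k by simp
  moreover have "is_minor (typed_grid (290 ^ h * (290 ^ h' * k)) ts) G"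
    unfolding ts(1) using k by (intro typed_grid_shrink_minor) (auto simp: power_add mult.assoc)
  ultimately show ?thesis
    using is_minor_trans by blast
qed

theorem theorem3p2:
  fixes g h c h0 c0 k :: nat
  assumes "g = 2 * h + c" and "g > 0" and "c > 0"
    and "int h0 = \<lceil>real c / 2\<rceil> - 1"
    and "int c0 = int c - 2 * int h0"
    and "k > 0"
  shows "(\<forall>G. mixed_surface_grid (162 ^ (2 * g) * k) h c G \<longrightarrow>
              is_minor (dyck_grid (h + h0) c0 k) G) \<and>
         (\<forall>H. mixed_surface_grid k h c H \<longrightarrow>
              is_minor H (dyck_grid (h + h0) c0 (162 ^ (2 * g) * k)))"
proof -
  \<comment> \<open>Strictness matters: it leaves at least one crosscap in the Dyck-grid, without
    which the exchanges could not start.\<close>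
  have "real_of_int (int h0) < real c / 2"
    unfolding assms(4) using ceiling_correct[of "real c / 2"] by simp
  then have h0: "2 * h0 < c"
    by linarith
  moreover have "c0 + 2 * h0 = c"
    using assms(5) by linarith
  ultimately have c0: "0 < c0" "2 * (h + h0) + c0 = 2 * h + c"
    by simp_all
  \<comment> \<open>The exponent is the total number of handles of the two grids; it is at most
    \<open>g\<close> because \<open>h0 < c\<close>, and 290 is below the square of 162.\<close>
  have "290 ^ (h + (h + h0)) \<le> (162\<^sup>2 :: nat) ^ (h + (h + h0))"
    by (intro power_mono) auto
  also have "\<dots> \<le> (162\<^sup>2) ^ g"
    using h0 assms(1) by (intro power_increasing) auto
  also have "\<dots> = 162 ^ (2 * g)"
    by (simp only: power_mult)
  finally have bound: "290 ^ (h + (h + h0)) * k \<le> 162 ^ (2 * g) * k"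
    by simp
  show ?thesis
  proof (intro conjI allI impI)
    fix G assume "mixed_surface_grid (162 ^ (2 * g) * k) h c G"
    from mixed_surface_grid_minor[OF this mixed_surface_grid_dyck_grid]
    show "is_minor (dyck_grid (h + h0) c0 k) G"
      using assms(3,6) c0 bound by simp
  next
    fix H assume "mixed_surface_grid k h c H"
    from mixed_surface_grid_minor[OF mixed_surface_grid_dyck_grid this]
    show "is_minor H (dyck_grid (h + h0) c0 (162 ^ (2 * g) * k))"
      using assms(3,6) c0 bound by (simp add: add.commute)
  qed
qed

end
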